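(* Let $n\ge 2$ and let $R$ be any $n\times n$ entrywise nonnegative real matrix. Then \[ \frac{1}{15}\cdot\frac{\Delta(R)}{n}\;\le\;\phi(R)\;\le\;\sqrt{2\cdot\Delta(R)}, \] where $\Delta(R)$ and $\phi(R)$ are the spectral gap and edge expansion defined in the context.
   Context: Irreducible: a nonnegative matrix $H$ is irreducible if for every pair $(s,t)$ there is $k>0$ with $(H^k)_{s,t}>0$. By the Perron–Frobenius theorem an irreducible nonnegative $H$ has a simple positive eigenvalue $\lambda_1(H)$ (the PF eigenvalue) with entrywise positive left and right eigenvectors $u$ and $v$ ($H^Tu=\lambda_1 u$, $Hv=\lambda_1 v$), and all other eigenvalues have real part $<\lambda_1(H)$. For irreducible nonnegative $H$, list its eigenvalues (roots of $\det(\lambda I-H)=0$, with multiplicity) as $\lambda_1(H)>\operatorname{Re}\lambda_2(H)\ge\cdots\ge\operatorname{Re}\lambda_n(H)$, and define the spectral gap $\Delta(H)=1-\operatorname{Re}\lambda_2(H)/\lambda_1(H)$. For irreducible nonnegative $H$ with positive PF left/right eigenvectors $u,v$, $D_u,D_v$ the diagonal matrices with $u$, $v$ on the diagonal, and $\mathbf 1_S$ the indicator vector of $S\subseteq[n]$, define for nonempty $S$ \[ \phi_S(H)=\frac{\langle \mathbf 1_S, D_uHD_v\mathbf 1_{\overline S}\rangle}{\langle \mathbf 1_S, D_uHD_v\mathbf 1\rangle},\qquad \phi(H)=\min_{\emptyset\ne S\subseteq[n]:\ \sum_{i\in S}u_iv_i\le\frac12\sum_i u_iv_i}\phi_S(H).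 \] For an arbitrary nonnegative $R$, let $R_\epsilon$ be the set of irreducible nonnegative $H$ with $\|R-H\|_F\le\epsilon$ (Frobenius norm) and define $\Delta(R)=\lim_{\epsilon\to0}\inf_{H\in R_\epsilon}\Delta(H)$ and $\phi(R)=\lim_{\epsilon\to0}\inf_{H\in R_\epsilon}\phi(H)$. *)

theory Defs
  imports "HOL-Analysis.Analysis" "HOL-Computational_Algebra.Polynomial"
          "HOL-Computational_Algebra.Fundamental_Theorem_Algebra"
begin

type_synonym 'n rmat = "real^'n^'n"

primrec matpow :: "'n::finite rmat \<Rightarrow> nat \<Rightarrow> 'n rmat" where
  "matpow H 0 = mat 1"
| "matpow H (Suc k) = H ** matpow H k"

definition nonneg_mat :: "'n::finite rmat \<Rightarrow> bool" where
  "nonneg_mat H \<longleftrightarrow> (\<forall>i j. H $ i $ j \<ge> 0)"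

definition irreducible_mat :: "'n::finite rmat \<Rightarrow> bool" where
  "irreducible_mat H \<longleftrightarrow> nonneg_mat H \<and>
     (\<forall>s t. \<exists>k>0. matpow H k $ s $ t > 0)"

definition charpoly :: "'n::finite rmat \<Rightarrow> complex poly" where
  "charpoly H = det (\<chi> i j. (if i = j then [:0, 1:] else 0) - [:complex_of_real (H $ i $ j):])"

definition eigenvalues_ms :: "'n::finite rmat \<Rightarrow> complex multiset" where
  "eigenvalues_ms H = proots (charpoly H)"

definition re_eigs_desc :: "'n::finite rmat \<Rightarrow> real list" where
  "re_eigs_desc H = rev (sorted_list_of_multiset (image_mset Re (eigenvalues_ms H)))"

definition lambda1 :: "'n::finite rmat \<Rightarrow> real" where
  "lambda1 H = re_eigs_desc H ! 0"

definition re_lambda2 :: "'n::finite rmat \<Rightarrow> real" where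
  "re_lambda2 H = re_eigs_desc H ! 1"

definition spectral_gap :: "'n::finite rmat \<Rightarrow> real" where
  "spectral_gap H = 1 - re_lambda2 H / lambda1 H"

text \<open>Positive left/right PF eigenvectors (chosen; phi_S is scale invariant).\<close>
definition pf_left :: "'n::finite rmat \<Rightarrow> real^'n" where
  "pf_left H = (SOME u. (\<forall>i. u $ i > 0) \<and> transpose H *v u = lambda1 H *\<^sub>R u)"

definition pf_right :: "'n::finite rmat \<Rightarrow> real^'n" where
  "pf_right H = (SOME v. (\<forall>i. v $ i > 0) \<and> H *v v = lambda1 H *\<^sub>R v)"

definition diag_mat :: "real^'n \<Rightarrow> real^'n^'n" where
  "diag_mat u = (\<chi> i j. if i = j then u $ i else 0)"

definition indic :: "'n::finite set \<Rightarrow> real^'n" where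
  "indic S = (\<chi> i. if i \<in> S then 1 else 0)"

definition phi_set :: "'n::finite rmat \<Rightarrow> 'n set \<Rightarrow> real" where
  "phi_set H S =
     (let u = pf_left H; v = pf_right H;
          A = diag_mat u ** H ** diag_mat v
      in (indic S \<bullet> (A *v indic (- S))) / (indic S \<bullet> (A *v indic UNIV)))"

definition edge_expansion :: "'n::finite rmat \<Rightarrow> real" where
  "edge_expansion H =
     (let u = pf_left H; v = pf_right H
      in Min (phi_set H ` {S. S \<noteq> {} \<and>
               (\<Sum>i\<in>S. u $ i * v $ i) \<le> (1/2) * (\<Sum>i\<in>UNIV. u $ i * v $ i)}))"

definition frob_dist :: "'n::finite rmat \<Rightarrow> 'n rmat \<Rightarrow> real" where
  "frob_dist R H = sqrt (\<Sum>i\<in>UNIV. \<Sum>j\<in>UNIV. (R $ i $ j - H $ i $ j)^2)"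

definition near_irred :: "'n::finite rmat \<Rightarrow> real \<Rightarrow> 'n rmat set" where
  "near_irred R \<epsilon> = {H. irreducible_mat H \<and> frob_dist R H \<le> \<epsilon>}"

definition spectral_gap_gen :: "'n::finite rmat \<Rightarrow> real" where
  "spectral_gap_gen R = Lim (at_right 0) (\<lambda>\<epsilon>. Inf (spectral_gap ` near_irred R \<epsilon>))"

definition edge_expansion_gen :: "'n::finite rmat \<Rightarrow> real" where
  "edge_expansion_gen R = Lim (at_right 0) (\<lambda>\<epsilon>. Inf (edge_expansion ` near_irred R \<epsilon>))"

end

theory Submission
  imports Defs
begin

text \<open>
  For irreducible \<open>H\<close> with Perron root \<open>r\<close> and Perron vectors \<open>u\<close>, \<open>v\<close>, the matrix
  \<open>P i j = H i j * v j / (r * v i)\<close> is stochastic with stationary weights \<open>p i\<close> proportional to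
  \<open>u i * v i\<close>. The quantity \<open>\<phi>\<^sub>S\<close> is the stationary flow out of \<open>S\<close> divided by \<open>p(S)\<close>, and the
  non-Perron eigenvalues of \<open>H / r\<close> are those of \<open>P\<close> on vectors of \<open>p\<close>-mean zero.

  The upper bound is Cheeger's inequality, applied to the real and imaginary parts of an eigenvector
  for \<open>\<lambda>\<^sub>2\<close>; the Perron root being a simple root of the characteristic polynomial guarantees that
  this eigenvector has mean zero.

  For the lower bound let \<open>\<Delta>\<close> be the gap, \<open>s = 1 / \<Delta>\<close> and \<open>B = (I + s (I - P))\<inverse>\<close>. This is a
  contraction in the maximum norm whose eigenvalues on mean-zero vectors have modulus at most \<open>1/2\<close>.
  Let \<open>\<mu>\<^sub>1, \<dots>, \<mu>\<^sub>N\<close> with \<open>N \<le> n\<close> be the roots of the minimal polynomial of the mean-zero part \<open>f\<close>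
  of the indicator of \<open>S\<close>. Expanding \<open>B\<^sup>k f\<close> in the vectors \<open>(B - \<mu>\<^sub>1) \<dots> (B - \<mu>\<^sub>i) f\<close> shows that it is
  exponentially small for \<open>k = 6 n\<close>. On the other hand each application of \<open>B\<close> moves at most
  \<open>s * flow S\<close> of the mass out of \<open>S\<close>, and \<open>6 n s * flow S\<close> must therefore be comparable with \<open>p(S)\<close>.
\<close>

section \<open>Annihilating polynomials and decay of powers\<close>

text \<open>This is the vector \<open>p(T) f\<close>, computed by Horner's rule. Folding over the
  coefficients avoids an algebra of operators and gives a recursion along
  \<open>pCons\<close>.\<close>

definition poly_orbit :: "(complex^'n \<Rightarrow> complex^'n) \<Rightarrow> complex^'n \<Rightarrow> complex poly \<Rightarrow> complex^'n" where
  "poly_orbit T f p = fold_coeffs (\<lambda>a v. a *s f + T v) p 0"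

context
  fixes T :: "complex^'n \<Rightarrow> complex^'n" and f :: "complex^'n"
  assumes lin: "Vector_Spaces.linear (*s) (*s) T"
begin

interpretation T: Vector_Spaces.linear "(*s)" "(*s)" T by (rule lin)

lemma poly_orbit_0 [simp]: "poly_orbit T f 0 = 0"
  by (simp add: poly_orbit_def)

lemma poly_orbit_pCons [simp]: "poly_orbit T f (pCons a p) = a *s f + T (poly_orbit T f p)"
  \<comment> \<open>The zero polynomial has no coefficients to fold over, so this case rests on
    \<open>T 0 = 0\<close>.\<close>
  by (cases "p = 0 \<and> a = 0") (auto simp: poly_orbit_def T.zero)

lemma poly_orbit_add: "poly_orbit T f (p + q) = poly_orbit T f p + poly_orbit T f q"
  by (induction p q rule: poly_induct2) (simp_all add: T.add vec.scale_left_distrib)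

lemma poly_orbit_smult: "poly_orbit T f (smult c p) = c *s poly_orbit T f p"
  by (induction p) (simp_all add: T.scale vec.scale_right_distrib)

lemma poly_orbit_sum: "poly_orbit T f (\<Sum>i\<in>A. p i) = (\<Sum>i\<in>A. poly_orbit T f (p i))"
  by (induction A rule: infinite_finite_induct) (simp_all add: poly_orbit_add)

lemma poly_orbit_monom: "poly_orbit T f (monom c i) = c *s (T ^^ i) f"
  by (induction i) (simp_all add: monom_0 monom_Suc T.zero T.scale)

lemma poly_orbit_linear_factor:
  "poly_orbit T f ([:- a, 1:] * p) = T (poly_orbit T f p) - a *s poly_orbit T f p"
proof -
  have "[:- a, 1:] * p = pCons 0 p + smult (- a) p"
    by simp
  then show ?thesis
    by (simp only: poly_orbit_add poly_orbit_smult poly_orbit_pCons vec.scale_minus_left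
        vec.scale_zero_left add_0 diff_conv_add_uminus)
qed

lemma poly_orbit_mem:
  assumes "vec.subspace U" "f \<in> U" "\<And>x. x \<in> U \<Longrightarrow> T x \<in> U"
  shows "poly_orbit T f p \<in> U"
  using assms by (induction p) (auto intro: vec.subspace_0 vec.subspace_add vec.subspace_scale)

text \<open>The n+1 vectors \<open>f\<close>, \<open>T f\<close>, ..., \<open>T^n f\<close> are
  dependent in dimension n. If two of them coincide, the set they form may be too small to be
  dependent, but then the difference of two monomials already annihilates \<open>f\<close>.\<close>

lemma ex_annihilating_poly: "\<exists>p. p \<noteq> 0 \<and> degree p \<le> CARD('n) \<and> poly_orbit T f p = 0"
proof (cases "inj_on (\<lambda>i. (T ^^ i) f) {..CARD('n)}")
  case False
  then obtain i j where ij: "i \<le> CARD('n)" "j \<le> CARD('n)" "i \<noteq> j" "(T ^^ i) f = (T ^^ j) f"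
    by (auto simp: inj_on_def)
  let ?p = "monom 1 i + monom (- 1) j :: complex poly"
  have "coeff ?p i = 1"
    using ij by simp
  then have "?p \<noteq> 0"
    by (metis coeff_0 zero_neq_one)
  moreover have "degree ?p \<le> CARD('n)"
    using ij by (intro degree_add_le) (auto intro: order_trans[OF degree_monom_le])
  moreover have "poly_orbit T f ?p = 0"
    using ij by (simp add: poly_orbit_add poly_orbit_monom vec.scale_minus_left)
  ultimately show ?thesis by blast
next
  case True
  let ?g = "\<lambda>i. (T ^^ i) f"
  let ?S = "?g ` {..CARD('n)}"
  have "card ?S = Suc (CARD('n))"
    using card_image[OF True] by simp
  then have "\<not> vec.independent ?S"
    using vec.independent_bound_general[of ?S] dim_subset_UNIV_cart_gen[of ?S] by auto
  then obtain u w where u: "(\<Sum>v\<in>?S. u v *s v) = 0" "w \<in> ?S" "u w \<noteq> 0"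
    unfolding vec.independent_explicit by auto
  then obtain k where k: "k \<le> CARD('n)" "u (?g k) \<noteq> 0"
    by auto
  let ?p = "\<Sum>i\<le>CARD('n). monom (u (?g i)) i"
  have "coeff ?p k = u (?g k)"
    using k by (simp add: coeff_sum)
  then have "?p \<noteq> 0"
    using k by (metis coeff_0)
  moreover have "degree ?p \<le> CARD('n)"
    by (intro degree_sum_le) (auto intro: order_trans[OF degree_monom_le])
  moreover have "poly_orbit T f ?p = 0"
    using u(1) by (simp add: poly_orbit_sum poly_orbit_monom sum.reindex[OF True])
  ultimately show ?thesis by blast
qed

text \<open>The \<open>\<mu> i\<close> are the roots of a minimal annihilating polynomial of \<open>f\<close>; minimality turns
  each cofactor of a root into an eigenvector.\<close>

lemma ex_eigenvalue_chain:
  assumes U: "vec.subspace U" "f \<in> U" "\<And>x. x \<in> U \<Longrightarrow> T x \<in> U"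
  obtains N \<mu> q where "N \<le> CARD('n)" "q 0 = f" "q N = 0"
    "\<And>i. q (Suc i) = T (q i) - \<mu> i *s q i"
    "\<And>i. i < N \<Longrightarrow> \<exists>y\<in>U. y \<noteq> 0 \<and> T y = \<mu> i *s y"
proof -
  define Q where "Q p \<longleftrightarrow> p \<noteq> 0 \<and> poly_orbit T f p = 0" for p
  obtain p0 where p0: "Q p0" "degree p0 \<le> CARD('n)"
    using ex_annihilating_poly Q_def by blast
  obtain p where p: "Q p" "\<And>r. Q r \<Longrightarrow> degree p \<le> degree r"
    using ex_has_least_nat[of Q p0 degree] p0 by blast
  obtain \<mu> where \<mu>: "smult (lead_coeff p) (\<Prod>i<degree p. [:- \<mu> i, 1:]) = p"
    using complex_poly_decompose' .
  define q where "q i = poly_orbit T f (\<Prod>j<i. [:- \<mu> j, 1:])" for i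
  have lc: "lead_coeff p \<noteq> 0"
    using p(1) by (simp add: Q_def)
  show ?thesis
  proof (rule that[of "degree p" q \<mu>])
    show "degree p \<le> CARD('n)"
      using p0 p(2) order_trans by blast
    show "q 0 = f"
      by (simp add: q_def T.zero one_pCons)
    have "lead_coeff p *s q (degree p) = 0"
      using p(1) \<mu> poly_orbit_smult[of "lead_coeff p" "\<Prod>i<degree p. [:- \<mu> i, 1:]"]
      by (simp add: q_def Q_def)
    then show "q (degree p) = 0"
      using lc by simp
    show "q (Suc i) = T (q i) - \<mu> i *s q i" for i
      unfolding q_def by (simp only: lessThan_Suc prod.insert[OF finite_lessThan] lessThan_iff
          less_irrefl not_False_eq_True poly_orbit_linear_factor)
    show "\<exists>y\<in>U. y \<noteq> 0 \<and> T y = \<mu> i *s y" if "i < degree p" for i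
    proof -
      define r where "r = smult (lead_coeff p) (\<Prod>j\<in>{..<degree p} - {i}. [:- \<mu> j, 1:])"
      have pr: "p = [:- \<mu> i, 1:] * r"
        using \<mu> that prod.remove[of "{..<degree p}" i "\<lambda>i. [:- \<mu> i, 1:]"]
        by (simp add: r_def mult_smult_right del: mult_pCons_left mult_pCons_right)
      then have r: "r \<noteq> 0"
        using p(1) by (auto simp: Q_def)
      then have "degree p = Suc (degree r)"
        by (subst pr, subst degree_mult_eq) auto
      then have "\<not> Q r"
        using p(2)[of r] by auto
      then have "poly_orbit T f r \<noteq> 0"
        using r by (simp add: Q_def)
      moreover have "T (poly_orbit T f r) = \<mu> i *s poly_orbit T f r"
        using p(1) poly_orbit_linear_factor[of "\<mu> i" r]
        by (simp only: Q_def flip: pr) simp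
      ultimately show ?thesis
        using poly_orbit_mem[OF U] by blast
    qed
  qed
qed

text \<open>By induction on \<open>k\<close>, \<open>T\<^sup>k (q i)\<close> is bounded by \<open>15\<^bsup>N-1\<^esup> (1/10)\<^sup>i (3/5)\<^sup>k\<close>: the rate is
  \<open>3/5 = 1/10 + 1/2\<close>, and \<open>15 = 10 * 3/2\<close> absorbs the growth \<open>norm (q i) \<le> (3/2)\<^sup>i\<close> of the chain.\<close>

lemma eigenvalue_chain_decay:
  assumes contr: "\<And>x b. (\<And>l. norm (x $ l) \<le> b) \<Longrightarrow> (\<And>l. norm (T x $ l) \<le> b)"
    and q: "q N = 0" "\<And>i. q (Suc i) = T (q i) - \<mu> i *s q i"
    and \<mu>: "\<And>i. i < N \<Longrightarrow> norm (\<mu> i) \<le> 1/2"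
    and q0: "\<And>l. norm (q 0 $ l) \<le> 1" and N: "0 < N"
  shows "norm ((T ^^ k) (q 0) $ l) \<le> 15 ^ (N - 1) * (3/5) ^ k"
proof -
  have grow: "norm (q i $ l) \<le> (3/2) ^ i" if "i < N" for i l
    using that
  proof (induction i arbitrary: l)
    case 0
    then show ?case using q0 by simp
  next
    case (Suc i)
    have "norm (q (Suc i) $ l) \<le> norm (T (q i) $ l) + norm (\<mu> i * q i $ l)"
      unfolding q(2) by (simp add: norm_triangle_ineq4)
    also have "\<dots> \<le> (3/2) ^ i + 1/2 * (3/2) ^ i"
    proof (rule add_mono)
      show "norm (T (q i) $ l) \<le> (3/2) ^ i"
        using Suc by (intro contr) auto
      show "norm (\<mu> i * q i $ l) \<le> 1/2 * (3/2) ^ i"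
        unfolding norm_mult using Suc \<mu>[of i] by (intro mult_mono) auto
    qed
    finally show ?case by simp
  qed
  have Tk: "(T ^^ k) (x + c *s y) = (T ^^ k) x + c *s (T ^^ k) y" for k c x y
    by (induction k) (simp_all add: T.add T.scale)
  have Tk0: "(T ^^ k) 0 = 0" for k
    by (induction k) (simp_all add: T.zero)
  have "norm ((T ^^ k) (q i) $ l) \<le> 15 ^ (N - 1) * (1/10) ^ i * (3/5) ^ k" if "i \<le> N" for i
    using that
  proof (induction k arbitrary: i l)
    case 0
    show ?case
    proof (cases "i = N")
      case False
      then have "(3/2 :: real) ^ i = 15 ^ i * (1/10) ^ i"
        by (simp flip: power_mult_distrib)
      also have "\<dots> \<le> 15 ^ (N - 1) * (1/10) ^ i"
        using 0 False by (intro mult_right_mono power_increasing) auto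
      finally show ?thesis
        using grow[of i l] 0 False by simp
    qed (use q in simp)
  next
    case (Suc k)
    show ?case
    proof (cases "i = N")
      case False
      then have i: "i < N" using Suc by simp
      have "T (q i) = q (Suc i) + \<mu> i *s q i"
        unfolding q(2) by simp
      then have "(T ^^ Suc k) (q i) = (T ^^ k) (q (Suc i)) + \<mu> i *s (T ^^ k) (q i)"
        by (simp only: funpow_Suc_right o_apply Tk)
      then have "norm ((T ^^ Suc k) (q i) $ l)
          \<le> norm ((T ^^ k) (q (Suc i)) $ l) + norm (\<mu> i * (T ^^ k) (q i) $ l)"
        by (simp add: norm_triangle_ineq)
      also have "\<dots> \<le> 15 ^ (N - 1) * (1/10) ^ Suc i * (3/5) ^ k
          + 1/2 * (15 ^ (N - 1) * (1/10) ^ i * (3/5) ^ k)"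
        unfolding norm_mult using Suc.IH[of "Suc i" l] Suc.IH[of i l] \<mu>[OF i] i
        by (intro add_mono mult_mono) auto
      also have "\<dots> = 15 ^ (N - 1) * (1/10) ^ i * (3/5) ^ Suc k"
        by simp
      finally show ?thesis .
    qed (use q Tk0[of "Suc k"] in simp)
  qed
  from this[of 0] show ?thesis by simp
qed

end

section \<open>Flow and spectral gap of a stationary chain\<close>

locale stationary_chain =
  fixes P :: "'n::finite \<Rightarrow> 'n \<Rightarrow> real" and p :: "'n \<Rightarrow> real"
  assumes P_nonneg: "0 \<le> P i j"
    and row_sum: "(\<Sum>j\<in>UNIV. P i j) = 1"
    and p_pos: "0 < p i"
    and p_sum: "(\<Sum>i\<in>UNIV. p i) = 1"
    and stationary: "(\<Sum>i\<in>UNIV. p i * P i j) = p j"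
begin

definition flow :: "'n set \<Rightarrow> real" where
  "flow S = (\<Sum>i\<in>S. \<Sum>j\<in>- S. p i * P i j)"

lemma p_nonneg: "0 \<le> p i"
  using p_pos[of i] by simp

lemma sum_split: "(\<Sum>j\<in>UNIV. g j) = (\<Sum>j\<in>S. g j) + (\<Sum>j\<in>- S. g j :: 'b::comm_monoid_add)"
  for S :: "'n set"
  using sum.union_disjoint[of S "- S" g] by simp

lemma flow_nonneg: "0 \<le> flow S"
  unfolding flow_def by (intro sum_nonneg mult_nonneg_nonneg P_nonneg p_nonneg)

lemma flow_le: "flow S \<le> sum p S"
proof -
  have "(\<Sum>j\<in>- S. p i * P i j) \<le> p i" for i
  proof -
    have "(\<Sum>j\<in>- S. p i * P i j) \<le> (\<Sum>j\<in>UNIV. p i * P i j)"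
      by (intro sum_mono2) (auto intro: mult_nonneg_nonneg P_nonneg p_nonneg)
    then show ?thesis
      by (simp add: row_sum flip: sum_distrib_left)
  qed
  then show ?thesis
    unfolding flow_def by (intro sum_mono)
qed

text \<open>Row sums and stationarity both express p(S) as the flow inside \<open>S\<close> plus a
  crossing flow: the outgoing one and the incoming one respectively.\<close>

lemma flow_reverse: "(\<Sum>i\<in>- S. \<Sum>j\<in>S. p i * P i j) = flow S"
proof -
  have "(\<Sum>i\<in>S. \<Sum>j\<in>UNIV. p i * P i j) = sum p S"
    by (simp add: row_sum flip: sum_distrib_left)
  then have "(\<Sum>i\<in>S. \<Sum>j\<in>S. p i * P i j) + flow S = sum p S"
    unfolding flow_def sum_split[of _ S] by (simp add: sum.distrib)
  moreover have "(\<Sum>j\<in>S. \<Sum>i\<in>UNIV. p i * P i j) = sum p S"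
    by (simp add: stationary)
  then have "(\<Sum>j\<in>S. \<Sum>i\<in>S. p i * P i j) + (\<Sum>j\<in>S. \<Sum>i\<in>- S. p i * P i j) = sum p S"
    unfolding sum_split[of _ S] by (simp add: sum.distrib)
  ultimately show ?thesis
    using sum.swap[of "\<lambda>j i. p i * P i j" S S] sum.swap[of "\<lambda>j i. p i * P i j" "- S" S] by simp
qed

text \<open>The matrix \<open>I + s (I - P)\<close>. Facts about its inverse \<open>B\<close> are
  all stated through this explicit matrix and applied to \<open>y = B x\<close>.\<close>

definition resolvent_inv :: "real \<Rightarrow> complex^'n^'n" where
  "resolvent_inv s = (\<chi> i j. (if i = j then of_real (1 + s) else 0) - of_real (s * P i j))"

lemma resolvent_inv_nth:
  "(resolvent_inv s *v x) $ i = of_real (1 + s) * x $ i - of_real s * (\<Sum>j\<in>UNIV. of_real (P i j) * x $ j)"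
proof -
  have "(resolvent_inv s *v x) $ i =
      (\<Sum>j\<in>UNIV. (if i = j then of_real (1 + s) * x $ j else 0) - of_real s * (of_real (P i j) * x $ j))"
    unfolding resolvent_inv_def matrix_vector_mult_def
    by (auto intro!: sum.cong simp: algebra_simps)
  then show ?thesis
    by (simp add: sum_subtractf flip: sum_distrib_left)
qed

lemma average_norm_le:
  assumes "\<And>j. norm (x $ j) \<le> (c :: real)"
  shows "norm (\<Sum>j\<in>UNIV. of_real (P i j) * x $ j :: complex) \<le> c"
proof -
  have "norm (\<Sum>j\<in>UNIV. of_real (P i j) * x $ j) \<le> (\<Sum>j\<in>UNIV. P i j * c)"
    using assms P_nonneg by (intro sum_norm_le) (auto simp: norm_mult intro!: mult_left_mono)
  then show ?thesis
    by (simp add: row_sum flip: sum_distrib_right)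
qed

text \<open>At a coordinate where the modulus of \<open>y\<close> attains its maximum
  \<open>m\<close>, the averaging property of \<open>P\<close> gives
  \<open>(1 + s) m <= b + s m\<close>. This yields contractivity of the inverse and, with
  \<open>b = 0\<close>, its existence.\<close>

lemma resolvent_norm_le:
  assumes s: "0 \<le> s" and b: "\<And>l. norm ((resolvent_inv s *v y) $ l) \<le> b"
  shows "norm (y $ l) \<le> b"
proof -
  define m where "m = Max (range (\<lambda>l. norm (y $ l)))"
  have m: "norm (y $ l) \<le> m" for l
    unfolding m_def by (intro Max_ge) auto
  have "m \<in> range (\<lambda>l. norm (y $ l))"
    unfolding m_def by (intro Max_in) auto
  then obtain i where i: "norm (y $ i) = m" by auto
  have "of_real (1 + s) * y $ i = (resolvent_inv s *v y) $ i + of_real s * (\<Sum>j\<in>UNIV. of_real (P i j) * y $ j)"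
    by (simp add: resolvent_inv_nth)
  then have "norm (of_real (1 + s) * y $ i) \<le> b + s * m"
    using s by (auto intro!: order_trans[OF norm_triangle_ineq] add_mono b mult_left_mono
        average_norm_le m simp: norm_mult)
  then have "(1 + s) * m \<le> b + s * m"
    using s i by (simp add: norm_mult del: of_real_add)
  then have "m \<le> b"
    by (simp add: algebra_simps)
  then show ?thesis
    using m[of l] by simp
qed

text \<open>Maximum principle: at a minimum of \<open>Re \<circ> y\<close> the average is at least \<open>Re \<circ> y\<close>.\<close>

lemma resolvent_Re_nonneg:
  assumes s: "0 \<le> s" and b: "\<And>l. 0 \<le> Re ((resolvent_inv s *v y) $ l)"
  shows "0 \<le> Re (y $ l)"
proof -
  define m where "m = Min (range (\<lambda>l. Re (y $ l)))"
  have m: "m \<le> Re (y $ l)" for l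
    unfolding m_def by (intro Min_le) auto
  have "m \<in> range (\<lambda>l. Re (y $ l))"
    unfolding m_def by (intro Min_in) auto
  then obtain i where i: "Re (y $ i) = m" by auto
  have "m = (\<Sum>j\<in>UNIV. P i j * m)"
    by (simp add: row_sum flip: sum_distrib_right)
  also have "\<dots> \<le> (\<Sum>j\<in>UNIV. P i j * Re (y $ j))"
    by (intro sum_mono mult_left_mono m P_nonneg)
  finally have "s * m \<le> s * (\<Sum>j\<in>UNIV. P i j * Re (y $ j))"
    using s by (rule mult_left_mono)
  moreover have "0 \<le> (1 + s) * m - s * (\<Sum>j\<in>UNIV. P i j * Re (y $ j))"
    using b[of i] i by (simp add: resolvent_inv_nth)
  ultimately have "0 \<le> m"
    by (simp add: algebra_simps)
  then show ?thesis
    using m[of l] by simp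
qed

lemma resolvent_inv_one: "resolvent_inv s *v 1 = 1"
  by (simp add: vec_eq_iff resolvent_inv_nth row_sum flip: of_real_sum)

text \<open>Stationarity makes \<open>p\<close> a left fixed vector of \<open>P\<close>, hence also
  of \<open>I + s (I - P)\<close>; so the inverse preserves the mean-zero subspace.\<close>

lemma resolvent_inv_mean:
  "(\<Sum>i\<in>UNIV. of_real (p i) * (resolvent_inv s *v y) $ i) = (\<Sum>i\<in>UNIV. of_real (p i) * y $ i)"
proof -
  have "(\<Sum>i\<in>UNIV. of_real (p i) * (\<Sum>j\<in>UNIV. of_real (P i j) * y $ j))
      = (\<Sum>j\<in>UNIV. \<Sum>i\<in>UNIV. of_real (p i * P i j) * y $ j)"
    by (subst sum.swap) (simp add: sum_distrib_left mult.assoc)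
  also have "\<dots> = (\<Sum>j\<in>UNIV. of_real (p j) * y $ j)"
    unfolding sum_distrib_right[symmetric] of_real_sum[symmetric] stationary ..
  finally have avg: "(\<Sum>i\<in>UNIV. of_real (p i) * (\<Sum>j\<in>UNIV. of_real (P i j) * y $ j))
      = (\<Sum>j\<in>UNIV. of_real (p j) * y $ j)" .
  have "(\<Sum>i\<in>UNIV. of_real (p i) * (resolvent_inv s *v y) $ i)
      = of_real (1 + s) * (\<Sum>i\<in>UNIV. of_real (p i) * y $ i)
        - of_real s * (\<Sum>i\<in>UNIV. of_real (p i) * (\<Sum>j\<in>UNIV. of_real (P i j) * y $ j))"
    by (simp add: resolvent_inv_nth sum_distrib_left sum_subtractf algebra_simps sum.distrib)
  then show ?thesis
    unfolding avg by (simp add: algebra_simps)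
qed

lemma ex_resolvent:
  assumes "0 \<le> s"
  shows "\<exists>B. resolvent_inv s ** B = mat 1 \<and> B ** resolvent_inv s = mat 1"
proof -
  have "x = 0" if "resolvent_inv s *v x = 0" for x
    using resolvent_norm_le[OF assms, of x 0] that by (simp add: vec_eq_iff)
  then obtain B where "B ** resolvent_inv s = mat 1"
    using matrix_left_invertible_ker[of "resolvent_inv s"] by blast
  then show ?thesis
    using matrix_left_right_inverse by blast
qed

text \<open>One application of the inverse loses at most \<open>s * flow S\<close> of the mass on
  \<open>S\<close>. Discarding what \<open>P\<close> averages in from outside \<open>S\<close>, the
  loss is \<open>s\<close> times the flow from \<open>- S\<close> into \<open>S\<close> weighted by
  \<open>y\<close>, and \<open>y\<close> is at most 1 there.\<close>

lemma sum_Re_resolvent_ge: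
  assumes s: "0 \<le> s" and y: "\<And>l. 0 \<le> Re (y $ l)" "\<And>l. Re (y $ l) \<le> 1"
  shows "(\<Sum>i\<in>S. p i * Re ((resolvent_inv s *v y) $ i)) - s * flow S \<le> (\<Sum>i\<in>S. p i * Re (y $ i))"
proof -
  let ?h = "\<lambda>i. Re (y $ i)"
  have col: "p j - (\<Sum>i\<in>S. p i * P i j) = (\<Sum>i\<in>- S. p i * P i j)" for j
    using sum_split[of "\<lambda>i. p i * P i j" S] stationary[of j] by linarith
  have "(\<Sum>i\<in>S. p i * ?h i) - (\<Sum>i\<in>S. p i * (\<Sum>j\<in>UNIV. P i j * ?h j))
      \<le> (\<Sum>i\<in>S. p i * ?h i) - (\<Sum>i\<in>S. \<Sum>j\<in>S. p i * P i j * ?h j)"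
    unfolding sum_distrib_left mult.assoc[symmetric]
    by (intro diff_left_mono sum_mono sum_mono2)
      (auto intro: mult_nonneg_nonneg P_nonneg p_nonneg y)
  also have "\<dots> = (\<Sum>j\<in>S. (p j - (\<Sum>i\<in>S. p i * P i j)) * ?h j)"
    by (subst sum.swap) (simp add: sum_subtractf sum_distrib_right left_diff_distrib)
  also have "\<dots> = (\<Sum>j\<in>S. (\<Sum>i\<in>- S. p i * P i j) * ?h j)"
    by (simp add: col)
  also have "\<dots> \<le> (\<Sum>j\<in>S. (\<Sum>i\<in>- S. p i * P i j) * 1)"
    by (intro sum_mono mult_left_mono y sum_nonneg mult_nonneg_nonneg P_nonneg p_nonneg)
  also have "\<dots> = flow S"
    unfolding flow_reverse[symmetric] mult_1_right by (rule sum.swap)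
  finally have "s * ((\<Sum>i\<in>S. p i * ?h i) - (\<Sum>i\<in>S. p i * (\<Sum>j\<in>UNIV. P i j * ?h j))) \<le> s * flow S"
    using s by (rule mult_left_mono)
  moreover have "(\<Sum>i\<in>S. p i * Re ((resolvent_inv s *v y) $ i))
      = (\<Sum>i\<in>S. p i * ?h i) + s * ((\<Sum>i\<in>S. p i * ?h i) - (\<Sum>i\<in>S. p i * (\<Sum>j\<in>UNIV. P i j * ?h j)))"
    by (simp add: resolvent_inv_nth sum_distrib_left sum_subtractf algebra_simps sum.distrib)
  ultimately show ?thesis by simp
qed

lemma flow_ge_gap:
  assumes \<Delta>: "0 < \<Delta>" and S: "sum p S \<le> 1/2"
    and gap: "\<And>\<mu> g. \<lbrakk>\<And>i. (\<Sum>j\<in>UNIV. of_real (P i j) * g j) = \<mu> * g i;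
        (\<Sum>i\<in>UNIV. of_real (p i) * g i) = 0; \<exists>i. g i \<noteq> 0\<rbrakk> \<Longrightarrow> Re \<mu> \<le> 1 - \<Delta>"
  shows "\<Delta> / (15 * real CARD('n)) * sum p S \<le> flow S"
proof -
  define s where "s = 1 / \<Delta>"
  have s: "0 < s" using \<Delta> by (simp add: s_def)
  obtain B where MB: "resolvent_inv s ** B = mat 1" and BM: "B ** resolvent_inv s = mat 1"
    using ex_resolvent[of s] s by auto
  have MBx: "resolvent_inv s *v (B *v x) = x" for x
    by (simp add: matrix_vector_mul_assoc MB)
  have B1: "B *v 1 = 1"
    using resolvent_inv_one[of s] by (metis BM matrix_vector_mul_assoc matrix_vector_mul_lid)
  let ?T = "\<lambda>x. B *v x"
  have lin: "Vector_Spaces.linear (*s) (*s) ?T"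
    by (rule matrix_vector_mul_linear_gen)
  have contr: "norm (?T x $ l) \<le> b" if "\<And>l. norm (x $ l) \<le> b" for x b l
    using resolvent_norm_le[of s "?T x" b] s that by (simp add: MBx)
  define U where "U = {x :: complex^'n. (\<Sum>i\<in>UNIV. of_real (p i) * x $ i) = 0}"
  have U: "vec.subspace U"
    unfolding U_def vec.subspace_def
    by (simp add: algebra_simps sum.distrib) (simp add: algebra_simps flip: sum_distrib_left)
  have TU: "?T x \<in> U" if "x \<in> U" for x
    using that resolvent_inv_mean[of s "?T x"] by (simp add: U_def MBx)
  define e :: "complex^'n" where "e = (\<chi> i. if i \<in> S then 1 else 0)"
  define c :: complex where "c = of_real (sum p S)"
  define f :: "complex^'n" where "f = e - c *s 1"
  have sum_e: "(\<Sum>i\<in>UNIV. of_real (p i) * e $ i) = c"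
    by (simp add: e_def c_def if_distrib sum.If_cases cong: if_cong)
  have "(\<Sum>i\<in>UNIV. of_real (p i) * f $ i)
      = (\<Sum>i\<in>UNIV. of_real (p i) * e $ i) - of_real (\<Sum>i\<in>UNIV. p i) * c"
    by (simp add: f_def right_diff_distrib sum_subtractf sum_distrib_right)
  then have fU: "f \<in> U"
    unfolding sum_e p_sum by (simp add: U_def)
  have pS: "0 \<le> sum p S"
    by (intro sum_nonneg p_nonneg)
  have f1: "norm (f $ l) \<le> 1" for l
  proof -
    have "f $ l = of_real ((if l \<in> S then 1 else 0) - sum p S)"
      by (simp add: f_def e_def c_def)
    then show ?thesis
      using pS S by (simp only: norm_of_real) auto
  qed
  obtain N \<mu> q where N: "N \<le> CARD('n)" and q: "q 0 = f" "q N = 0"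
    "\<And>i. q (Suc i) = ?T (q i) - \<mu> i *s q i"
    and ev: "\<And>i. i < N \<Longrightarrow> \<exists>y\<in>U. y \<noteq> 0 \<and> ?T y = \<mu> i *s y"
    using ex_eigenvalue_chain[OF lin U fU TU] by metis
  have \<mu>: "norm (\<mu> i) \<le> 1/2" if i: "i < N" for i
  proof -
    obtain y where y: "y \<in> U" "y \<noteq> 0" "?T y = \<mu> i *s y"
      using ev[OF i] by blast
    have "\<mu> i *s (resolvent_inv s *v y) = y"
      using MBx[of y] by (simp add: y(3) vec.scale)
    then have eq: "y $ l = \<mu> i * (of_real (1 + s) * y $ l - of_real s * (\<Sum>j\<in>UNIV. of_real (P l j) * y $ j))" for l
      by (metis resolvent_inv_nth vector_smult_component)
    have \<mu>0: "\<mu> i \<noteq> 0"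
      using eq y(2) by (auto simp: vec_eq_iff)
    \<comment> \<open>An eigenvalue \<open>\<mu> i\<close> of \<open>B\<close> corresponds to the
      eigenvalue \<open>(1 + s - 1 / \<mu> i) / s\<close> of \<open>P\<close>. The gap then forces
      \<open>Re (1 / \<mu> i)\<close> to be at least \<open>1 + s \<Delta> = 2\<close>, which
      explains the choice of \<open>s\<close>.\<close>
    have "(\<Sum>j\<in>UNIV. of_real (P l j) * y $ j) = ((of_real (1 + s) - 1 / \<mu> i) / of_real s) * y $ l" for l
      using eq[of l] \<mu>0 s by (simp add: field_simps)
    then have "Re ((of_real (1 + s) - 1 / \<mu> i) / of_real s) \<le> 1 - \<Delta>"
      using y by (intro gap[of "\<lambda>i. y $ i"]) (auto simp: U_def vec_eq_iff)
    then have "(1 + s - Re (1 / \<mu> i)) / s \<le> 1 - \<Delta>"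
      by simp
    then have "2 \<le> Re (1 / \<mu> i)"
      using s \<Delta> by (simp add: field_simps s_def)
    also have "\<dots> \<le> norm (1 / \<mu> i)"
      by (rule complex_Re_le_cmod)
    finally show ?thesis
      using \<mu>0 by (simp add: norm_divide field_simps)
  qed
  let ?n = "CARD('n)"
  \<comment> \<open>The factor 6 is chosen because \<open>15 * (3/5)^6\<close> is about 0.7, below
    1, so that \<open>k\<close> steps beat the prefactor \<open>15 ^ (n - 1)\<close>.\<close>
  define k where "k = 6 * ?n"
  have decay: "norm ((?T ^^ k) f $ l) \<le> 1/20" for l
  \<comment> \<open>The decay estimate needs a chain of positive length; length zero means
    \<open>f = 0\<close>.\<close>
  proof (cases "N = 0")
    case True
    then have "f = 0" using q by simp
    moreover have "(?T ^^ k) 0 = 0"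
      by (induction k) simp_all
    ultimately show ?thesis by simp
  next
    case False
    have "norm ((?T ^^ k) f $ l) \<le> 15 ^ (N - 1) * (3/5) ^ k"
      using eigenvalue_chain_decay[OF lin contr, of q N \<mu> k l] q \<mu> f1 False by simp
    also have "\<dots> \<le> 15 ^ (?n - 1) * (3/5) ^ k"
      using N by (intro mult_right_mono power_increasing) auto
    also have "\<dots> = (15 * (3/5) ^ 6) ^ ?n / 15"
      unfolding k_def power_mult power_mult_distrib
      by (simp add: power_eq_if)
    also have "\<dots> \<le> (15 * (3/5) ^ 6) / 15"
    proof (rule divide_right_mono)
      have "15 * (3/5) ^ 6 \<le> (1 :: real)"
        by (simp add: power_divide)
      then show "(15 * (3/5) ^ 6) ^ ?n \<le> (15 * (3/5) ^ 6 :: real)"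
        using power_decreasing[of 1 ?n "15 * (3/5) ^ 6 :: real"] zero_less_card_finite[where 'a='n]
        by (simp only: Suc_leI One_nat_def power_one_right) simp
    qed simp
    also have "\<dots> \<le> 1/20"
      by (simp add: power_divide)
    finally show ?thesis .
  qed
  \<comment> \<open>The range [0,1] is carried along because the bound on the loss per step requires
    it.\<close>
  have "(\<forall>l. 0 \<le> Re ((?T ^^ m) e $ l) \<and> Re ((?T ^^ m) e $ l) \<le> 1)
      \<and> sum p S - m * s * flow S \<le> (\<Sum>i\<in>S. p i * Re ((?T ^^ m) e $ i))" for m
  proof (induction m)
    case 0
    have "(\<Sum>i\<in>S. p i * Re (e $ i)) = sum p S"
      by (simp add: e_def)
    then show ?case by (simp add: e_def)
  next
    case (Suc m)
    let ?x = "(?T ^^ m) e"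
    have 0: "0 \<le> Re (?T ?x $ l)" for l
      using resolvent_Re_nonneg[of s "?T ?x" l] s Suc by (simp add: MBx)
    \<comment> \<open>Since \<open>B\<close> fixes the constant 1, \<open>1 - B x\<close> is the
      image of the nonnegative vector \<open>1 - x\<close>.\<close>
    have 1: "Re (?T ?x $ l) \<le> 1" for l
      using resolvent_Re_nonneg[of s "1 - ?T ?x" l] s Suc
      by (simp add: MBx matrix_vector_mult_diff_distrib resolvent_inv_one)
    show ?case
      using 0 1 sum_Re_resolvent_ge[of s "?T ?x" S] s Suc by (simp add: MBx algebra_simps)
  qed
  then have "sum p S - k * s * flow S \<le> (\<Sum>i\<in>S. p i * Re ((?T ^^ k) e $ i))" by blast
  also have "\<dots> \<le> (\<Sum>i\<in>S. p i * (1/20 + 1/2))"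
  proof (intro sum_mono mult_left_mono p_nonneg)
    fix i
    have "(?T ^^ m) e = (?T ^^ m) f + c *s 1" for m
      by (induction m) (simp_all add: f_def vec.add vec.scale B1)
    then have "Re ((?T ^^ k) e $ i) = Re ((?T ^^ k) f $ i) + sum p S"
      by (simp add: c_def)
    also have "\<dots> \<le> 1/20 + 1/2"
      using decay[of i] S complex_Re_le_cmod[of "(?T ^^ k) f $ i"] by linarith
    finally show "Re ((?T ^^ k) e $ i) \<le> 1/20 + 1/2" .
  qed
  \<comment> \<open>At least p(S) minus \<open>k s flow S\<close> remains on \<open>S\<close>, but
    at most 11/20 of p(S) can. Dividing 6 by 9/20 gives 40/3, which is rounded up to 15.\<close>
  finally have "9/20 * sum p S \<le> 6 * ?n / \<Delta> * flow S"
    by (simp add: k_def s_def field_simps flip: sum_distrib_right sum_distrib_left sum_divide_distrib)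
  then have "\<Delta> * sum p S \<le> 40/3 * ?n * flow S"
    using \<Delta> by (simp add: field_simps)
  also have "\<dots> \<le> 15 * ?n * flow S"
    using flow_nonneg by (intro mult_right_mono) auto
  finally show ?thesis
    by (simp add: field_simps)
qed

end

section \<open>Cheeger's inequality\<close>

context stationary_chain
begin

lemma sum_out: "(\<Sum>i\<in>UNIV. \<Sum>j\<in>UNIV. p i * P i j * c i) = (\<Sum>i\<in>UNIV. p i * (c i :: real))"
  by (simp add: row_sum mult_ac flip: sum_distrib_left sum_distrib_right)

lemma sum_in: "(\<Sum>i\<in>UNIV. \<Sum>j\<in>UNIV. p i * P i j * c j) = (\<Sum>j\<in>UNIV. p j * (c j :: real))"
  by (subst sum.swap) (simp add: stationary flip: sum_distrib_right)

text \<open>A discrete co-area formula: the support is peeled off one level at a time.\<close>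

lemma coarea:
  fixes q :: "'n \<Rightarrow> real"
  assumes "\<And>i. 0 \<le> q i"
    and "\<And>S. \<lbrakk>S \<noteq> {}; S \<subseteq> {i. 0 < q i}\<rbrakk> \<Longrightarrow> \<phi> * sum p S \<le> flow S"
  shows "\<phi> * (\<Sum>i\<in>UNIV. p i * q i) \<le> (\<Sum>i\<in>UNIV. \<Sum>j\<in>UNIV. p i * P i j * max (q i - q j) 0)"
  using assms
proof (induction "card {i. 0 < q i}" arbitrary: q rule: less_induct)
  case less
  define S where "S = {i. 0 < q i}"
  have q0: "q i = 0" if "i \<notin> S" for i
    using less.prems(1)[of i] that by (simp add: S_def)
  show ?case
  proof (cases "S = {}")
    case True
    then show ?thesis using q0 by simp
  next
    case False
    define m where "m = Min (q ` S)"
    have m_le: "m \<le> q i" if "i \<in> S" for i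
      using that by (simp add: m_def)
    have "m \<in> q ` S"
      using False by (simp add: m_def)
    then obtain k where k: "k \<in> S" "q k = m" by auto
    then have m: "0 < m" by (auto simp: S_def)
    define r where "r i = q i - (if i \<in> S then m else 0)" for i
    have r_nonneg: "0 \<le> r i" for i
      using m_le[of i] less.prems(1)[of i] by (simp add: r_def)
    have r_supp: "{i. 0 < r i} \<subseteq> S"
      using q0 by (auto simp: r_def split: if_splits)
    have "k \<notin> {i. 0 < r i}"
      using k by (simp add: r_def)
    then have "card {i. 0 < r i} < card {i. 0 < q i}"
      using r_supp k S_def by (intro psubset_card_mono) auto
    then have IH: "\<phi> * (\<Sum>i\<in>UNIV. p i * r i) \<le> (\<Sum>i\<in>UNIV. \<Sum>j\<in>UNIV. p i * P i j * max (r i - r j) 0)"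
      using r_nonneg r_supp S_def by (intro less.hyps less.prems(2)) auto
    have "(\<Sum>i\<in>UNIV. p i * (if i \<in> S then m else 0)) = m * sum p S"
      by (simp add: if_distrib sum.If_cases sum_distrib_left mult.commute cong: if_cong)
    then have lhs: "(\<Sum>i\<in>UNIV. p i * q i) = (\<Sum>i\<in>UNIV. p i * r i) + m * sum p S"
      by (simp add: r_def right_diff_distrib sum_subtractf)
    \<comment> \<open>Lowering \<open>q\<close> by \<open>m\<close> on \<open>S\<close> keeps
      differences within \<open>S\<close>; only pairs leaving \<open>S\<close> change, by exactly
      \<open>m\<close>, because \<open>q\<close> vanishes outside \<open>S\<close>.\<close>
    have "max (q i - q j) 0 = max (r i - r j) 0 + (if i \<in> S \<and> j \<notin> S then m else 0)" for i j
      using m_le[of i] m_le[of j] q0[of i] q0[of j] m by (auto simp: r_def max_def)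
    then have "(\<Sum>i\<in>UNIV. \<Sum>j\<in>UNIV. p i * P i j * max (q i - q j) 0)
        = (\<Sum>i\<in>UNIV. \<Sum>j\<in>UNIV. p i * P i j * max (r i - r j) 0)
          + (\<Sum>i\<in>UNIV. \<Sum>j\<in>UNIV. p i * P i j * (if i \<in> S \<and> j \<notin> S then m else 0))"
      by (simp add: distrib_left sum.distrib)
    also have "(\<Sum>i\<in>UNIV. \<Sum>j\<in>UNIV. p i * P i j * (if i \<in> S \<and> j \<notin> S then m else 0))
        = (\<Sum>i\<in>UNIV. if i \<in> S then \<Sum>j\<in>UNIV. if j \<in> - S then p i * P i j * m else 0 else 0)"
      by (intro sum.cong refl) (auto intro: sum.cong)
    also have "\<dots> = m * flow S"
      by (simp only: sum.inter_restrict[symmetric] finite Int_UNIV_left flow_def sum_distrib_left)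
        (simp add: mult_ac)
    finally have rhs: "(\<Sum>i\<in>UNIV. \<Sum>j\<in>UNIV. p i * P i j * max (q i - q j) 0)
        = (\<Sum>i\<in>UNIV. \<Sum>j\<in>UNIV. p i * P i j * max (r i - r j) 0) + m * flow S" .
    have "m * (\<phi> * sum p S) \<le> m * flow S"
      using less.prems(2)[of S] False S_def m by (intro mult_left_mono) auto
    then show ?thesis
      unfolding lhs rhs using IH by (simp add: algebra_simps)
  qed
qed

text \<open>The co-area bound is applied to the square of \<open>h\<close>. Writing
  \<open>2 max(x,0) = x + |x|\<close>, the \<open>x\<close> part sums to zero by stationarity, and
  the arithmetic-geometric mean inequality with weight \<phi> bounds \<open>|x|\<close>. Its second
  term sums to \<open>\<phi> * ?A\<close>, half of the left-hand side, and is absorbed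
  there.\<close>

lemma energy_ge_nonneg:
  fixes h :: "'n \<Rightarrow> real"
  assumes h: "\<And>i. 0 \<le> h i" and \<phi>: "0 \<le> \<phi>"
    and "\<And>S. \<lbrakk>S \<noteq> {}; S \<subseteq> {i. 0 < h i}\<rbrakk> \<Longrightarrow> \<phi> * sum p S \<le> flow S"
  shows "\<phi>\<^sup>2 * (\<Sum>i\<in>UNIV. p i * (h i)\<^sup>2) \<le> (\<Sum>i\<in>UNIV. \<Sum>j\<in>UNIV. p i * P i j * (h i - h j)\<^sup>2)"
proof (cases "\<phi> = 0")
  case True
  then show ?thesis
    by (auto intro!: sum_nonneg mult_nonneg_nonneg P_nonneg p_nonneg)
next
  case False
  with \<phi> have \<phi>: "0 < \<phi>" by simp
  let ?A = "\<Sum>i\<in>UNIV. p i * (h i)\<^sup>2"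
  let ?D = "\<Sum>i\<in>UNIV. \<Sum>j\<in>UNIV. p i * P i j * (h i - h j)\<^sup>2"
  have supp: "{i. 0 < (h i)\<^sup>2} = {i. 0 < h i}"
    using h by (auto simp: less_le)
  have 1: "\<phi> * ?A \<le> (\<Sum>i\<in>UNIV. \<Sum>j\<in>UNIV. p i * P i j * max ((h i)\<^sup>2 - (h j)\<^sup>2) 0)"
  proof (rule coarea)
    show "\<phi> * sum p S \<le> flow S" if "S \<noteq> {}" "S \<subseteq> {i. 0 < (h i)\<^sup>2}" for S
      using that unfolding supp by (rule assms(3))
  qed simp
  have pt: "2 * max ((h i)\<^sup>2 - (h j)\<^sup>2) 0
      \<le> (h i)\<^sup>2 - (h j)\<^sup>2 + ((h i - h j)\<^sup>2 / \<phi> + \<phi> / 2 * ((h i)\<^sup>2 + (h j)\<^sup>2))" for i j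
  proof -
    have "0 \<le> (\<bar>h i - h j\<bar> / \<phi> - (h i + h j) / 2)\<^sup>2 * \<phi>"
      using \<phi> by simp
    also have "\<dots> = (h i - h j)\<^sup>2 / \<phi> + \<phi> / 4 * (h i + h j)\<^sup>2 - \<bar>h i - h j\<bar> * (h i + h j)"
      using \<phi> by (simp add: power2_diff power_divide field_simps power2_eq_square)
    finally have "\<bar>h i - h j\<bar> * (h i + h j) \<le> (h i - h j)\<^sup>2 / \<phi> + \<phi> / 4 * (h i + h j)\<^sup>2" by simp
    also have "\<phi> / 4 * (h i + h j)\<^sup>2 \<le> \<phi> / 4 * (2 * ((h i)\<^sup>2 + (h j)\<^sup>2))"
      using \<phi> zero_le_power2[of "h i - h j"]
      by (intro mult_left_mono) (auto simp: power2_eq_square algebra_simps)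
    finally have "\<bar>h i - h j\<bar> * (h i + h j) \<le> (h i - h j)\<^sup>2 / \<phi> + \<phi> / 2 * ((h i)\<^sup>2 + (h j)\<^sup>2)"
      by (simp add: field_simps)
    moreover have "\<bar>h i - h j\<bar> * (h i + h j) = \<bar>(h i)\<^sup>2 - (h j)\<^sup>2\<bar>"
      using h[of i] h[of j] by (simp add: power2_eq_square square_diff_square_factored abs_mult mult.commute)
    ultimately show ?thesis by (auto simp: max_def)
  qed
  have "2 * (\<phi> * ?A) \<le> 2 * (\<Sum>i\<in>UNIV. \<Sum>j\<in>UNIV. p i * P i j * max ((h i)\<^sup>2 - (h j)\<^sup>2) 0)"
    using 1 by simp
  also have "\<dots> = (\<Sum>i\<in>UNIV. \<Sum>j\<in>UNIV. p i * P i j * (2 * max ((h i)\<^sup>2 - (h j)\<^sup>2) 0))"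
    by (simp add: sum_distrib_left mult_ac)
  also have "\<dots> \<le> (\<Sum>i\<in>UNIV. \<Sum>j\<in>UNIV. p i * P i j *
      ((h i)\<^sup>2 - (h j)\<^sup>2 + ((h i - h j)\<^sup>2 / \<phi> + \<phi> / 2 * ((h i)\<^sup>2 + (h j)\<^sup>2))))"
    by (intro sum_mono mult_left_mono pt mult_nonneg_nonneg P_nonneg p_nonneg)
  also have "\<dots> = (\<Sum>i\<in>UNIV. \<Sum>j\<in>UNIV. p i * P i j * (h i)\<^sup>2) - (\<Sum>i\<in>UNIV. \<Sum>j\<in>UNIV. p i * P i j * (h j)\<^sup>2)
      + ?D / \<phi> + \<phi> / 2 * ((\<Sum>i\<in>UNIV. \<Sum>j\<in>UNIV. p i * P i j * (h i)\<^sup>2) + (\<Sum>i\<in>UNIV. \<Sum>j\<in>UNIV. p i * P i j * (h j)\<^sup>2))"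
    by (simp add: sum_distrib_left sum_divide_distrib sum.distrib sum_subtractf algebra_simps)
  also have "\<dots> = ?D / \<phi> + \<phi> * ?A"
    unfolding sum_out[of "\<lambda>i. (h i)\<^sup>2"] sum_in[of "\<lambda>i. (h i)\<^sup>2"] by simp
  finally show ?thesis
    using \<phi> by (simp add: field_simps power2_eq_square)
qed

text \<open>Take the least value of \<open>g\<close> with mass at most 1/2 strictly above it. The
  next smaller value fails this test, so more than half of the mass lies above it, leaving at most
  half below the chosen value.\<close>

lemma ex_median:
  fixes g :: "'n \<Rightarrow> real"
  obtains m where "sum p {i. m < g i} \<le> 1/2" "sum p {i. g i < m} \<le> 1/2"
proof -
  define A where "A = {x \<in> range g. sum p {j. x < g j} \<le> 1/2}"
  have fin: "finite A" by (simp add: A_def)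
  have "{j. Max (range g) < g j} = {}"
    by (auto simp: not_less)
  then have "sum p {j. Max (range g) < g j} = 0"
    by (simp only: sum.empty)
  then have "Max (range g) \<in> A"
    using Max_in[of "range g"] unfolding A_def by simp
  then have A: "Min A \<in> A"
    using fin by (intro Min_in) auto
  have "sum p {i. g i < Min A} \<le> 1/2"
  proof (cases "{i. g i < Min A} = {}")
    case False
    define B where "B = {x \<in> range g. x < Min A}"
    have B: "Max B \<in> B"
      using False by (intro Max_in) (auto simp: B_def)
    then have "Max B < Min A"
      by (simp add: B_def)
    then have "Max B \<notin> A"
      using Min_le[OF fin] leD by blast
    then have "1/2 < sum p {j. Max B < g j}"
      using B by (auto simp: A_def B_def)
    moreover have "g i \<le> Max B" if "g i < Min A" for i
      using that by (intro Max_ge) (auto simp: B_def)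
    then have "{i. g i < Min A} \<subseteq> - {j. Max B < g j}"
      using leD by blast
    then have "sum p {i. g i < Min A} \<le> sum p (- {j. Max B < g j})"
      by (intro sum_mono2) (auto intro: p_nonneg)
    ultimately show ?thesis
      using sum_split[of p "{j. Max B < g j}"] p_sum by simp
  qed simp
  then show ?thesis
    using that A by (auto simp: A_def)
qed

text \<open>Subtracting a median splits \<open>g\<close> into a positive and a negative part, each
  supported on a set of mass at most 1/2, where the flow hypothesis is available.\<close>

lemma energy_ge:
  fixes g :: "'n \<Rightarrow> real"
  assumes g: "(\<Sum>i\<in>UNIV. p i * g i) = 0" and \<phi>: "0 \<le> \<phi>"
    and flow: "\<And>S. \<lbrakk>S \<noteq> {}; sum p S \<le> 1/2\<rbrakk> \<Longrightarrow> \<phi> * sum p S \<le> flow S"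
  shows "\<phi>\<^sup>2 * (\<Sum>i\<in>UNIV. p i * (g i)\<^sup>2) \<le> (\<Sum>i\<in>UNIV. \<Sum>j\<in>UNIV. p i * P i j * (g i - g j)\<^sup>2)"
proof -
  obtain m where m: "sum p {i. m < g i} \<le> 1/2" "sum p {i. g i < m} \<le> 1/2"
    using ex_median .
  define a where "a i = max (g i - m) 0" for i
  define b where "b i = max (m - g i) 0" for i
  have flow': "\<phi> * sum p S \<le> flow S" if "S \<noteq> {}" "S \<subseteq> V" "sum p V \<le> 1/2" for S V
    using that sum_mono2[of V S p] p_nonneg by (intro flow) auto
  have supp: "{i. 0 < a i} = {i. m < g i}" "{i. 0 < b i} = {i. g i < m}"
    by (auto simp: a_def b_def)
  have a: "\<phi>\<^sup>2 * (\<Sum>i\<in>UNIV. p i * (a i)\<^sup>2) \<le> (\<Sum>i\<in>UNIV. \<Sum>j\<in>UNIV. p i * P i j * (a i - a j)\<^sup>2)"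
    and b: "\<phi>\<^sup>2 * (\<Sum>i\<in>UNIV. p i * (b i)\<^sup>2) \<le> (\<Sum>i\<in>UNIV. \<Sum>j\<in>UNIV. p i * P i j * (b i - b j)\<^sup>2)"
    by (rule energy_ge_nonneg[OF _ \<phi>], simp add: a_def b_def, unfold supp, erule flow', assumption, rule m)+
  have ab: "(a i)\<^sup>2 + (b i)\<^sup>2 = (g i - m)\<^sup>2" for i
    by (auto simp: a_def b_def max_def power2_commute)
  \<comment> \<open>A mean-zero function has its least second moment about 0, so shifting by the
    median can only increase it.\<close>
  have "(\<Sum>i\<in>UNIV. p i * (g i)\<^sup>2) \<le> (\<Sum>i\<in>UNIV. p i * (g i)\<^sup>2) - 2 * m * (\<Sum>i\<in>UNIV. p i * g i) + m\<^sup>2 * (\<Sum>i\<in>UNIV. p i)"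
    using g p_sum by simp
  also have "\<dots> = (\<Sum>i\<in>UNIV. p i * (g i - m)\<^sup>2)"
    by (simp add: power2_diff sum_distrib_left sum_distrib_right sum.distrib sum_subtractf algebra_simps)
  also have "\<dots> = (\<Sum>i\<in>UNIV. p i * (a i)\<^sup>2) + (\<Sum>i\<in>UNIV. p i * (b i)\<^sup>2)"
    by (simp add: distrib_left sum.distrib flip: ab)
  finally have "\<phi>\<^sup>2 * (\<Sum>i\<in>UNIV. p i * (g i)\<^sup>2)
      \<le> \<phi>\<^sup>2 * ((\<Sum>i\<in>UNIV. p i * (a i)\<^sup>2) + (\<Sum>i\<in>UNIV. p i * (b i)\<^sup>2))"
    by (rule mult_left_mono) simp
  also have "\<dots> \<le> (\<Sum>i\<in>UNIV. \<Sum>j\<in>UNIV. p i * P i j * ((a i - a j)\<^sup>2 + (b i - b j)\<^sup>2))"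
    using a b by (simp add: distrib_left sum.distrib)
  also have "\<dots> \<le> (\<Sum>i\<in>UNIV. \<Sum>j\<in>UNIV. p i * P i j * (g i - g j)\<^sup>2)"
  proof (intro sum_mono mult_left_mono mult_nonneg_nonneg P_nonneg p_nonneg)
    fix i j
    \<comment> \<open>The square of \<open>g i - g j\<close> exceeds the two separate squares by
      \<open>2 (a i * b j + a j * b i)\<close>, as \<open>a\<close> and \<open>b\<close> have
      disjoint supports.\<close>
    have "0 \<le> a i * b j" "0 \<le> a j * b i" "a i * b i = 0" "a j * b j = 0" "g i - m = a i - b i" "g j - m = a j - b j"
      by (auto simp: a_def b_def max_def)
    then have "(g i - g j)\<^sup>2 = ((a i - b i) - (a j - b j))\<^sup>2"
      by (metis diff_diff_eq2 diff_add_cancel)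
    then show "(a i - a j)\<^sup>2 + (b i - b j)\<^sup>2 \<le> (g i - g j)\<^sup>2"
      using \<open>0 \<le> a i * b j\<close> \<open>0 \<le> a j * b i\<close> \<open>a i * b i = 0\<close> \<open>a j * b j = 0\<close>
      by (simp add: power2_eq_square algebra_simps)
  qed
  finally show ?thesis .
qed

text \<open>Real and imaginary parts of \<open>g\<close> need not be eigenvectors, but both have
  mean zero. When their energies are added the \<open>Im \<mu>\<close> terms cancel, leaving
  \<open>2 (1 - Re \<mu>)\<close> times the squared norm.\<close>

lemma cheeger:
  fixes g :: "'n \<Rightarrow> complex"
  assumes \<phi>: "0 \<le> \<phi>" and flow: "\<And>S. \<lbrakk>S \<noteq> {}; sum p S \<le> 1/2\<rbrakk> \<Longrightarrow> \<phi> * sum p S \<le> flow S"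
    and ev: "\<And>i. (\<Sum>j\<in>UNIV. of_real (P i j) * g j) = \<mu> * g i"
    and mean: "(\<Sum>i\<in>UNIV. of_real (p i) * g i) = 0" and nz: "g k \<noteq> 0"
  shows "\<phi>\<^sup>2 \<le> 2 * (1 - Re \<mu>)"
proof -
  let ?a = "\<lambda>i. Re (g i)" and ?b = "\<lambda>i. Im (g i)"
  let ?N = "\<Sum>i\<in>UNIV. p i * ((?a i)\<^sup>2 + (?b i)\<^sup>2)"
  have avg: "(\<Sum>j\<in>UNIV. P i j * ?a j) = Re \<mu> * ?a i - Im \<mu> * ?b i"
    "(\<Sum>j\<in>UNIV. P i j * ?b j) = Re \<mu> * ?b i + Im \<mu> * ?a i" for i
    using arg_cong[OF ev[of i], of Re] arg_cong[OF ev[of i], of Im] by simp_all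
  have energy: "(\<Sum>i\<in>UNIV. \<Sum>j\<in>UNIV. p i * P i j * (c i - c j)\<^sup>2)
      = 2 * (\<Sum>i\<in>UNIV. p i * (c i)\<^sup>2) - 2 * (\<Sum>i\<in>UNIV. p i * c i * (\<Sum>j\<in>UNIV. P i j * c j))" for c :: "'n \<Rightarrow> real"
  proof -
    have "(\<Sum>i\<in>UNIV. \<Sum>j\<in>UNIV. p i * P i j * (c i - c j)\<^sup>2)
        = (\<Sum>i\<in>UNIV. \<Sum>j\<in>UNIV. p i * P i j * (c i)\<^sup>2) + (\<Sum>i\<in>UNIV. \<Sum>j\<in>UNIV. p i * P i j * (c j)\<^sup>2)
          - 2 * (\<Sum>i\<in>UNIV. \<Sum>j\<in>UNIV. p i * P i j * (c i * c j))"
      by (simp add: power2_diff sum_distrib_left sum.distrib sum_subtractf algebra_simps)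
    then show ?thesis
      unfolding sum_out[of "\<lambda>i. (c i)\<^sup>2"] sum_in[of "\<lambda>i. (c i)\<^sup>2"]
      by (simp add: sum_distrib_left mult_ac)
  qed
  have "\<phi>\<^sup>2 * ?N = \<phi>\<^sup>2 * (\<Sum>i\<in>UNIV. p i * (?a i)\<^sup>2) + \<phi>\<^sup>2 * (\<Sum>i\<in>UNIV. p i * (?b i)\<^sup>2)"
    by (simp add: distrib_left sum.distrib)
  also have "\<dots> \<le> (\<Sum>i\<in>UNIV. \<Sum>j\<in>UNIV. p i * P i j * (?a i - ?a j)\<^sup>2)
      + (\<Sum>i\<in>UNIV. \<Sum>j\<in>UNIV. p i * P i j * (?b i - ?b j)\<^sup>2)"
    using arg_cong[OF mean, of Re] arg_cong[OF mean, of Im]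
    by (intro add_mono energy_ge \<phi> flow) simp_all
  also have "\<dots> = 2 * ?N - 2 * (Re \<mu> * ?N)"
    unfolding energy avg
    by (simp add: sum_distrib_left sum.distrib sum_subtractf algebra_simps power2_eq_square)
  finally have "\<phi>\<^sup>2 * ?N \<le> 2 * (1 - Re \<mu>) * ?N"
    by (simp add: algebra_simps)
  moreover have "0 < ?N"
  proof (rule sum_pos2[of _ k])
    show "0 < p k * ((?a k)\<^sup>2 + (?b k)\<^sup>2)"
      using p_pos nz by (auto simp: complex_eq_iff sum_power2_gt_zero_iff)
  qed (auto intro: mult_nonneg_nonneg p_nonneg)
  ultimately show ?thesis
    by (simp del: of_real_add)
qed

end

section \<open>Nonnegative matrices and the characteristic polynomial\<close>

lemma matpow_commute: "matpow H k ** H = H ** matpow H k"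
  by (induction k) (simp_all, metis matrix_mul_assoc)

lemma matpow_transpose: "matpow (transpose H) k = transpose (matpow H k)"
proof (induction k)
  case (Suc k)
  have "transpose (matpow H (Suc k)) = transpose (matpow H k ** H)"
    by (simp add: matpow_commute)
  then show ?case
    by (simp add: Suc matrix_transpose_mul)
qed (simp add: transpose_mat)

lemma irreducible_transpose:
  assumes "irreducible_mat H"
  shows "irreducible_mat (transpose H)"
  using assms unfolding irreducible_mat_def nonneg_mat_def matpow_transpose
  by (simp add: transpose_def)

lemma matpow_nonneg: "nonneg_mat H \<Longrightarrow> 0 \<le> matpow H k $ i $ j"
  by (induction k arbitrary: i j)
    (auto simp: nonneg_mat_def mat_def matrix_matrix_mult_def intro!: sum_nonneg)

lemma matpow_eigenvector: "H *v x = c *\<^sub>R x \<Longrightarrow> matpow H k *v x = c ^ k *\<^sub>R x"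
  by (induction k) (simp_all add: matrix_vector_mult_scaleR flip: matrix_vector_mul_assoc)

text \<open>Some coordinate \<open>j\<close> is positive, and a power \<open>k\<close> with positive
  entry at \<open>(i, j)\<close> carries this to \<open>c^k x_i > 0\<close>. That \<open>k\<close>
  is positive excludes \<open>c = 0\<close>.\<close>

lemma irreducible_nonneg_eigenvector:
  assumes H: "irreducible_mat H" and x: "H *v x = c *\<^sub>R x" "\<And>i. 0 \<le> x $ i" "x \<noteq> 0"
  shows "0 < c \<and> 0 < x $ i"
proof -
  obtain j where j: "0 < x $ j"
    using x(2,3) by (auto simp: vec_eq_iff less_le)
  obtain k where k: "0 < k" "0 < matpow H k $ i $ j"
    using H unfolding irreducible_mat_def by blast
  have "0 < matpow H k $ i $ j * x $ j"
    using j k by simp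
  also have "\<dots> \<le> (\<Sum>l\<in>UNIV. matpow H k $ i $ l * x $ l)"
    using H x(2) by (intro member_le_sum) (auto simp: irreducible_mat_def matpow_nonneg)
  also have "\<dots> = c ^ k * x $ i"
    using matpow_eigenvector[OF x(1), of k]
    by (simp add: vec_eq_iff matrix_vector_mult_def)
  finally have pos: "0 < c ^ k * x $ i" .
  then have xi: "0 < x $ i"
    using x(2)[of i] by (metis less_le mult_zero_right)
  have "c * x $ i = (\<Sum>l\<in>UNIV. H $ i $ l * x $ l)"
    using x(1) by (simp add: vec_eq_iff matrix_vector_mult_def)
  also have "\<dots> \<ge> 0"
    using H x(2) by (intro sum_nonneg) (auto simp: irreducible_mat_def nonneg_mat_def)
  finally have "0 \<le> c"
    using xi by (simp add: zero_le_mult_iff)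
  moreover have "c \<noteq> 0"
    using pos k by (auto simp: power_0_left)
  ultimately show ?thesis
    using xi by simp
qed

text \<open>Brouwer's theorem on the probability simplex for the map sending \<open>x\<close> to
  \<open>H x\<close> divided by its coordinate sum \<open>t x\<close>. This sum cannot vanish:
  otherwise \<open>x\<close> would be a nonnegative eigenvector for 0.\<close>

lemma ex_perron_vector:
  fixes H :: "real^'n^'n"
  assumes H: "irreducible_mat H"
  obtains c v where "0 < c" "\<And>i. 0 < v $ i" "H *v v = c *\<^sub>R v"
proof -
  define S where "S = cbox 0 1 \<inter> {x :: real^'n. (\<Sum>i\<in>UNIV. x $ i) = 1}"
  have S: "x \<in> S \<longleftrightarrow> (\<forall>i. 0 \<le> x $ i) \<and> (\<Sum>i\<in>UNIV. x $ i) = 1" for x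
  proof -
    have "x $ i \<le> (\<Sum>i\<in>UNIV. x $ i)" if "\<forall>i. 0 \<le> x $ i" for i
      using that by (intro member_le_sum) auto
    then show ?thesis
      by (auto simp: S_def mem_box_cart)
  qed
  have nz: "x \<noteq> 0" if "x \<in> S" for x
    using that by (auto simp: S)
  define t where "t x = (\<Sum>i\<in>UNIV. (H *v x) $ i)" for x
  have Hx: "0 \<le> (H *v x) $ i" if "x \<in> S" for x i
    using that H unfolding matrix_vector_mult_def
    by (auto simp: S irreducible_mat_def nonneg_mat_def intro!: sum_nonneg)
  have t: "0 < t x" if "x \<in> S" for x
  proof (rule ccontr)
    assume "\<not> 0 < t x"
    then have "t x = 0"
      using sum_nonneg[of UNIV "\<lambda>i. (H *v x) $ i"] Hx[OF that] by (auto simp: t_def)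
    then have "H *v x = 0"
      using Hx[OF that] by (simp add: t_def sum_nonneg_eq_0_iff vec_eq_iff)
    then have "H *v x = 0 *\<^sub>R x" by simp
    then show False
      using irreducible_nonneg_eigenvector[OF H] nz[OF that] that by (metis S less_irrefl)
  qed
  have "compact S"
    unfolding S_def by (intro compact_Int_closed compact_cbox closed_Collect_eq continuous_intros)
  moreover have "convex S"
    unfolding convex_def
  proof (intro ballI allI impI)
    fix x y and a b :: real
    assume "x \<in> S" "y \<in> S" and ab: "0 \<le> a" "0 \<le> b" "a + b = 1"
    then show "a *\<^sub>R x + b *\<^sub>R y \<in> S"
      by (simp add: S sum.distrib flip: sum_distrib_left)
  qed
  moreover have "axis i 1 \<in> S" for i
    by (simp add: S axis_def)
  then have "S \<noteq> {}" by blast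
  moreover have "continuous_on S (\<lambda>x. inverse (t x) *\<^sub>R (H *v x))"
    using t unfolding t_def by (intro continuous_intros) (metis less_irrefl)
  moreover have "(\<lambda>x. inverse (t x) *\<^sub>R (H *v x)) \<in> S \<rightarrow> S"
  proof
    fix x assume x: "x \<in> S"
    then show "inverse (t x) *\<^sub>R (H *v x) \<in> S"
      using t[OF x] Hx[OF x] by (simp add: S flip: sum_distrib_left) (simp flip: t_def)
  qed
  ultimately obtain x where x: "x \<in> S" "inverse (t x) *\<^sub>R (H *v x) = x"
    by (rule brouwer)
  then have "t x *\<^sub>R (inverse (t x) *\<^sub>R (H *v x)) = t x *\<^sub>R x"
    by simp
  then have "H *v x = t x *\<^sub>R x"
    using t[OF x(1)] by simp
  then show ?thesis
    using irreducible_nonneg_eigenvector[OF H, of x "t x"] nz[OF x(1)] x(1) that S by blast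
qed

section \<open>Determinants and the characteristic polynomial\<close>

lemma det_eq_0_iff_ker:
  fixes A :: "'a::field^'n^'n"
  shows "det A = 0 \<longleftrightarrow> (\<exists>z. z \<noteq> 0 \<and> A *v z = 0)"
  by (metis invertible_det_nz invertible_left_inverse matrix_left_invertible_ker)

lemma det_col_mul:
  fixes A :: "'a::comm_ring_1^'n^'n"
  shows "det (\<chi> i j. if j = k then c * b i else A $ i $ j) = c * det (\<chi> i j. if j = k then b i else A $ i $ j)"
proof -
  have "transpose (\<chi> i j. if j = k then c * b i else A $ i $ j)
      = (\<chi> j. if j = k then c *s (\<chi> i. b i) else column j A)"
    "transpose (\<chi> i j. if j = k then b i else A $ i $ j)
      = (\<chi> j. if j = k then (\<chi> i. b i) else column j A)"
    by (simp_all add: transpose_def vec_eq_iff column_def)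
  then show ?thesis
    using det_row_mul[of k c "\<lambda>_. \<chi> i. b i" "\<lambda>j. column j A"] by (metis (no_types) det_transpose)
qed

lemma poly_det:
  fixes A :: "'a::comm_ring_1 poly^'n^'n"
  shows "poly (det A) x = det (\<chi> i j. poly (A $ i $ j) x)"
  by (simp add: det_def poly_sum poly_prod)

lemma poly_charpoly:
  "poly (charpoly H) x = det (\<chi> i j. (if i = j then x else 0) - complex_of_real (H $ i $ j))"
  unfolding charpoly_def poly_det by (rule arg_cong[of _ _ det]) (simp add: vec_eq_iff)

text \<open>Written in coordinates because \<open>H\<close> is real while the eigenvector is
  complex.\<close>

definition eigenpair :: "real^'n^'n \<Rightarrow> complex \<Rightarrow> complex^'n \<Rightarrow> bool" where
  "eigenpair H \<mu> y \<longleftrightarrow> y \<noteq> 0 \<and> (\<forall>i. (\<Sum>j\<in>UNIV. of_real (H $ i $ j) * y $ j) = \<mu> * y $ i)"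

lemma charpoly_matrix_mult_nth:
  "((\<chi> i j. (if i = j then x else 0) - complex_of_real (H $ i $ j)) *v y) $ i
    = x * y $ i - (\<Sum>j\<in>UNIV. of_real (H $ i $ j) * y $ j)"
  by (simp add: matrix_vector_mult_def left_diff_distrib sum_subtractf if_distrib[of "\<lambda>a. a * _"] cong: if_cong)

lemma poly_charpoly_eq_0_iff: "poly (charpoly H) \<mu> = 0 \<longleftrightarrow> (\<exists>y. eigenpair H \<mu> y)"
  unfolding poly_charpoly det_eq_0_iff_ker
  unfolding eigenpair_def vec_eq_iff[of "_ *v _"] charpoly_matrix_mult_nth by auto

text \<open>The degree bound is proved alongside so that, on adding a factor, its constant term
  cannot contribute to the new top coefficient.\<close>

lemma coeff_prod_linear:
  fixes a b :: "'i \<Rightarrow> 'a::comm_ring_1"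
  assumes "finite S"
  shows "degree (\<Prod>i\<in>S. [:a i, b i:]) \<le> card S \<and> coeff (\<Prod>i\<in>S. [:a i, b i:]) (card S) = (\<Prod>i\<in>S. b i)"
  using assms
proof induction
  case (insert i S)
  let ?q = "\<Prod>i\<in>S. [:a i, b i:]"
  have "degree ([:a i, b i:] * ?q) \<le> Suc 0 + card S"
    using insert by (intro order_trans[OF degree_mult_le] add_mono) (auto simp: degree_pCons_eq_if)
  moreover have "coeff ?q (Suc (card S)) = 0"
    using insert by (intro coeff_eq_0) simp
  ultimately show ?case
    using insert by simp
qed simp

text \<open>In the Leibniz expansion the coefficients of degree n add up to the determinant of the
  identity. Hence at least n eigenvalues are listed and, for \<open>n >= 2\<close>, a second one
  exists.\<close>

lemma card_le_degree_charpoly: "CARD('n) \<le> degree (charpoly (H :: real^'n::finite^'n))"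
proof -
  let ?b = "\<lambda>i j :: 'n. (if i = j then 1 else 0) :: complex"
  have "charpoly H = det (\<chi> i j. [:- of_real (H $ i $ j), ?b i j:])"
    unfolding charpoly_def by (rule arg_cong[of _ _ det]) (simp add: vec_eq_iff)
  also have "coeff \<dots> CARD('n) = det (\<chi> i j. ?b i j)"
    unfolding det_def coeff_sum
  proof (rule sum.cong)
    fix \<pi> :: "'n \<Rightarrow> 'n"
    let ?q = "\<Prod>i\<in>UNIV. [:- of_real (H $ i $ \<pi> i), ?b i (\<pi> i):]"
    have "of_int (sign \<pi>) * ?q = smult (of_int (sign \<pi>)) ?q"
      by (simp add: of_int_poly)
    then show "coeff (of_int (sign \<pi>) * (\<Prod>i\<in>UNIV. (\<chi> i j. [:- of_real (H $ i $ j), ?b i j:]) $ i $ \<pi> i)) CARD('n)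
        = of_int (sign \<pi>) * (\<Prod>i\<in>UNIV. (\<chi> i j. ?b i j) $ i $ \<pi> i)"
      using coeff_prod_linear[of UNIV "\<lambda>i. - of_real (H $ i $ \<pi> i)" "\<lambda>i. ?b i (\<pi> i)"] by simp
  qed simp
  also have "\<dots> = 1"
    using det_I[where 'a=complex and 'n='n] by (simp add: mat_def)
  finally show ?thesis
    by (intro le_degree) simp
qed

lemma rev_sorted_list_of_multiset_add_max:
  assumes "\<And>y. y \<in># M \<Longrightarrow> y \<le> (x :: 'a::linorder)"
  shows "rev (sorted_list_of_multiset (add_mset x M)) = x # rev (sorted_list_of_multiset M)"
proof -
  have "sort (sorted_list_of_multiset M @ [x]) = sorted_list_of_multiset M @ [x]"
    using assms by (intro sorted_sort_id) (auto simp: sorted_append)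
  then have "sorted_list_of_multiset (mset (sorted_list_of_multiset M @ [x])) = sorted_list_of_multiset M @ [x]"
    unfolding sorted_list_of_multiset_mset .
  then show ?thesis by simp
qed

section \<open>Perron vectors\<close>

text \<open>The root and the vectors are arbitrary here: only after \<open>lambda1 H = r\<close> is
  derived inside the locale can it be instantiated with the chosen vectors \<open>pf_left\<close>
  and \<open>pf_right\<close>.\<close>

locale perron =
  fixes H :: "real^'n::finite^'n" and r :: real and u v :: "real^'n"
  assumes irreducible: "irreducible_mat H"
    and r_pos: "0 < r"
    and u_pos: "0 < u $ i" and v_pos: "0 < v $ i"
    and u_left: "transpose H *v u = r *\<^sub>R u"
    and v_right: "H *v v = r *\<^sub>R v"
begin

lemma H_nonneg: "0 \<le> H $ i $ j"
  using irreducible by (simp add: irreducible_mat_def nonneg_mat_def)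

lemma left_sum: "(\<Sum>i\<in>UNIV. u $ i * H $ i $ j) = r * u $ j"
  using u_left by (simp add: vec_eq_iff matrix_vector_mult_def transpose_def mult.commute)

lemma left_sum_complex:
  "(\<Sum>i\<in>UNIV. of_real (u $ i) * (\<Sum>j\<in>UNIV. of_real (H $ i $ j) * y $ j))
    = (of_real r * (\<Sum>i\<in>UNIV. of_real (u $ i) * y $ i) :: complex)"
proof -
  have "(\<Sum>i\<in>UNIV. of_real (u $ i) * (\<Sum>j\<in>UNIV. of_real (H $ i $ j) * y $ j))
      = (\<Sum>j\<in>UNIV. of_real (\<Sum>i\<in>UNIV. u $ i * H $ i $ j) * y $ j)"
    unfolding sum_distrib_left of_real_sum sum_distrib_right
    by (subst sum.swap) (simp add: mult.assoc)
  then show ?thesis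
    by (simp add: left_sum sum_distrib_left mult.assoc)
qed

lemma right_sum: "(\<Sum>j\<in>UNIV. H $ i $ j * v $ j) = r * v $ i"
  using v_right by (simp add: vec_eq_iff matrix_vector_mult_def)

text \<open>Take moduli in the eigenvalue equation and pair with the positive left eigenvector
  \<open>u\<close>, which turns \<open>H\<close> into the factor \<open>r\<close>.\<close>

lemma eigenvalue_norm_le:
  assumes "eigenpair H \<mu> y"
  shows "norm \<mu> \<le> r"
proof -
  have "norm \<mu> * (\<Sum>i\<in>UNIV. u $ i * norm (y $ i)) = (\<Sum>i\<in>UNIV. u $ i * norm (\<mu> * y $ i))"
    by (simp add: sum_distrib_left norm_mult mult_ac)
  also have "\<dots> \<le> (\<Sum>i\<in>UNIV. u $ i * (\<Sum>j\<in>UNIV. H $ i $ j * norm (y $ j)))"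
  proof (intro sum_mono mult_left_mono)
    fix i
    have "norm (\<Sum>j\<in>UNIV. of_real (H $ i $ j) * y $ j) \<le> (\<Sum>j\<in>UNIV. H $ i $ j * norm (y $ j))"
      by (intro sum_norm_le) (simp add: norm_mult H_nonneg)
    then show "norm (\<mu> * y $ i) \<le> (\<Sum>j\<in>UNIV. H $ i $ j * norm (y $ j))"
      using assms by (simp add: eigenpair_def)
  qed (simp add: u_pos less_imp_le)
  also have "\<dots> = (\<Sum>j\<in>UNIV. (\<Sum>i\<in>UNIV. u $ i * H $ i $ j) * norm (y $ j))"
    unfolding sum_distrib_left sum_distrib_right by (subst sum.swap) (simp add: mult.assoc)
  also have "\<dots> = r * (\<Sum>i\<in>UNIV. u $ i * norm (y $ i))"
    by (simp add: left_sum sum_distrib_left mult.assoc)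
  finally have le: "norm \<mu> * (\<Sum>i\<in>UNIV. u $ i * norm (y $ i)) \<le> r * (\<Sum>i\<in>UNIV. u $ i * norm (y $ i))" .
  obtain k where k: "y $ k \<noteq> 0"
    using assms by (auto simp: eigenpair_def vec_eq_iff)
  have "0 < (\<Sum>i\<in>UNIV. u $ i * norm (y $ i))"
    by (rule sum_pos2[of _ k]) (use k u_pos in \<open>auto simp: less_imp_le\<close>)
  then show ?thesis
    using le by simp
qed

text \<open>Subtracting the largest multiple of \<open>v\<close> that keeps \<open>x\<close>
  nonnegative leaves a nonnegative eigenvector with a zero coordinate, which irreducibility forces
  to vanish.\<close>

lemma real_eigenvector_unique:
  assumes x: "H *v x = r *\<^sub>R x"
  shows "\<exists>c. x = c *\<^sub>R v"
proof -
  define c where "c = Min (range (\<lambda>i. x $ i / v $ i))"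
  have "c \<in> range (\<lambda>i. x $ i / v $ i)"
    unfolding c_def by (intro Min_in) auto
  then obtain k where k: "c = x $ k / v $ k" by auto
  define z where "z = x - c *\<^sub>R v"
  have c_le: "c \<le> x $ i / v $ i" for i
    unfolding c_def by (intro Min_le) auto
  have "0 \<le> z $ i" for i
    using c_le[of i] v_pos[of i] by (simp add: z_def pos_le_divide_eq)
  moreover have "H *v z = r *\<^sub>R z"
    using x v_right by (simp add: z_def matrix_vector_mult_diff_distrib matrix_vector_mult_scaleR algebra_simps)
  moreover have "z $ k = 0"
    using v_pos[of k] by (simp add: z_def k)
  ultimately have "z = 0"
    using irreducible_nonneg_eigenvector[OF irreducible, of z r k] by auto
  then show ?thesis
    by (auto simp: z_def)
qed

lemma eigenvector_unique:
  assumes "eigenpair H (of_real r) y"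
  shows "\<exists>c. \<forall>i. y $ i = c * of_real (v $ i)"
proof -
  have eq: "(\<Sum>j\<in>UNIV. of_real (H $ i $ j) * y $ j) = of_real r * y $ i" for i
    using assms by (simp add: eigenpair_def)
  have "H *v (\<chi> i. Re (y $ i)) = r *\<^sub>R (\<chi> i. Re (y $ i))" "H *v (\<chi> i. Im (y $ i)) = r *\<^sub>R (\<chi> i. Im (y $ i))"
    using arg_cong[OF eq, of Re] arg_cong[OF eq, of Im]
    by (simp_all add: vec_eq_iff matrix_vector_mult_def)
  then obtain a b where "(\<chi> i. Re (y $ i)) = a *\<^sub>R v" "(\<chi> i. Im (y $ i)) = b *\<^sub>R v"
    using real_eigenvector_unique by metis
  then have "\<forall>i. y $ i = Complex a b * of_real (v $ i)"
    by (simp add: vec_eq_iff complex_eq_iff)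
  then show ?thesis by blast
qed

lemma eigenpair_mean:
  assumes "eigenpair H \<mu> y" "\<mu> \<noteq> of_real r"
  shows "(\<Sum>i\<in>UNIV. of_real (u $ i) * y $ i) = 0"
proof -
  have "\<mu> * (\<Sum>i\<in>UNIV. of_real (u $ i) * y $ i) = (\<Sum>i\<in>UNIV. of_real (u $ i) * (\<Sum>j\<in>UNIV. of_real (H $ i $ j) * y $ j))"
    using assms by (simp add: eigenpair_def sum_distrib_left mult_ac)
  also have "\<dots> = of_real r * (\<Sum>i\<in>UNIV. of_real (u $ i) * y $ i)"
    by (rule left_sum_complex)
  finally show ?thesis
    using assms(2) by simp
qed

lemma uv_sum_pos: "0 < (\<Sum>i\<in>UNIV. u $ i * v $ i)"
  by (intro sum_pos mult_pos_pos u_pos v_pos) auto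

lemma mean_zero_eigenvalue_neq:
  assumes "eigenpair H \<mu> y" "(\<Sum>i\<in>UNIV. of_real (u $ i) * y $ i) = 0"
  shows "\<mu> \<noteq> of_real r"
proof
  assume "\<mu> = of_real r"
  then obtain c where c: "\<forall>i. y $ i = c * of_real (v $ i)"
    using eigenvector_unique assms(1) by blast
  have "c * of_real (\<Sum>i\<in>UNIV. u $ i * v $ i) = 0"
    using assms(2) by (simp add: c sum_distrib_left mult_ac)
  then have "c = 0"
    using uv_sum_pos by (metis mult_eq_0_iff of_real_eq_0_iff less_irrefl)
  then show False
    using assms(1) c by (simp add: eigenpair_def vec_eq_iff)
qed

lemma eigenpair_perron: "eigenpair H (of_real r) (\<chi> i. of_real (v $ i))"
proof -
  have "v $ i \<noteq> 0" for i
    using v_pos[of i] by simp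
  then show ?thesis
    by (simp add: eigenpair_def vec_eq_iff right_sum flip: of_real_mult of_real_sum)
qed

lemma charpoly_nonzero: "charpoly H \<noteq> 0"
proof
  assume "charpoly H = 0"
  then obtain y where "eigenpair H (of_real (r + 1)) y"
    using poly_charpoly_eq_0_iff[of H "of_real (r + 1)"] by auto
  then show False
    using eigenvalue_norm_le[of "of_real (r + 1)"] r_pos by (simp del: of_real_add)
qed

text \<open>Replacing a column \<open>k\<close> of \<open>x I - H\<close> by \<open>v\<close> divides the determinant by \<open>x - r\<close>
  up to the factor \<open>v $ k\<close> (Cramer's rule), and what is left is nonsingular at \<open>x = r\<close>.\<close>

lemma order_perron: "order (of_real r) (charpoly H) = 1"
proof -
  fix k :: 'n
  let ?X = "\<lambda>x. \<chi> i j. (if i = j then x else 0) - complex_of_real (H $ i $ j)"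
  let ?v = "\<chi> i. complex_of_real (v $ i)"
  define N where "N = det (\<chi> i j. if j = k then [:complex_of_real (v $ i):]
      else [:- complex_of_real (H $ i $ j), if i = j then 1 else 0:])"
  have N: "poly N x = det (\<chi> i j. if j = k then ?v $ i else ?X x $ i $ j)" for x
    unfolding N_def poly_det by (rule arg_cong[of _ _ det]) (simp add: vec_eq_iff)
  have Xv: "(?X x *v ?v) $ i = (x - of_real r) * ?v $ i" for x i
    using eigenpair_perron unfolding charpoly_matrix_mult_nth
    by (simp add: eigenpair_def left_diff_distrib)
  have "?v $ k * poly (charpoly H) x = (x - of_real r) * poly N x" for x
    using cramer_lemma[of k "?X x" ?v] unfolding N poly_charpoly Xv det_col_mul by (rule sym)
  then have "poly (smult (of_real (v $ k)) (charpoly H)) = poly ([:- of_real r, 1:] * N)"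
    by (auto simp: fun_eq_iff algebra_simps)
  then have eq: "smult (of_real (v $ k)) (charpoly H) = [:- of_real r, 1:] * N"
    by (simp only: poly_eq_poly_eq_iff)
  have vk: "complex_of_real (v $ k) \<noteq> 0"
    using v_pos[of k] by simp
  have "poly N (of_real r) \<noteq> 0"
  proof
    assume "poly N (of_real r) = 0"
    then obtain z where z: "z \<noteq> 0" "(\<chi> i j. if j = k then ?v $ i else ?X (of_real r) $ i $ j) *v z = 0"
      unfolding N det_eq_0_iff_ker by blast
    define y where "y = (\<chi> j. if j = k then 0 else z $ j)"
    have zy: "of_real (v $ i) * z $ k + (of_real r * y $ i - (\<Sum>j\<in>UNIV. of_real (H $ i $ j) * y $ j)) = 0" for i
    proof -
      have "0 = (\<Sum>j\<in>UNIV. (if j = k then ?v $ i else ?X (of_real r) $ i $ j) * z $ j)"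
        using z(2) by (simp add: vec_eq_iff matrix_vector_mult_def)
      also have "\<dots> = (\<Sum>j\<in>UNIV. (if j = k then of_real (v $ i) * z $ k else 0) + ?X (of_real r) $ i $ j * y $ j)"
        by (intro sum.cong) (auto simp: y_def)
      also have "\<dots> = of_real (v $ i) * z $ k + (?X (of_real r) *v y) $ i"
        by (simp add: sum.distrib matrix_vector_mult_def)
      finally show ?thesis
        unfolding charpoly_matrix_mult_nth by simp
    qed
    \<comment> \<open>Pairing with \<open>u\<close> kills the \<open>y\<close> part, since
      \<open>u\<close> is a left eigenvector for \<open>r\<close>. So \<open>z $ k = 0\<close>, and
      \<open>z\<close> is a multiple of \<open>v\<close> with a vanishing entry.\<close>
    have "0 = (\<Sum>i\<in>UNIV. of_real (u $ i) * (of_real (v $ i) * z $ k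
        + (of_real r * y $ i - (\<Sum>j\<in>UNIV. of_real (H $ i $ j) * y $ j))))"
      by (simp add: zy)
    also have "\<dots> = of_real (\<Sum>i\<in>UNIV. u $ i * v $ i) * z $ k
        + (of_real r * (\<Sum>i\<in>UNIV. of_real (u $ i) * y $ i)
          - (\<Sum>i\<in>UNIV. of_real (u $ i) * (\<Sum>j\<in>UNIV. of_real (H $ i $ j) * y $ j)))"
      unfolding distrib_left right_diff_distrib sum.distrib sum_subtractf
      by (simp add: sum_distrib_left sum_distrib_right mult_ac)
    finally have "of_real (\<Sum>i\<in>UNIV. u $ i * v $ i) * z $ k = 0"
      unfolding left_sum_complex by simp
    then have zk: "z $ k = 0"
      using uv_sum_pos by (metis mult_eq_0_iff of_real_eq_0_iff less_irrefl)
    then have "y = z"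
      by (auto simp: y_def vec_eq_iff)
    then have "eigenpair H (of_real r) z"
      using zy z(1) zk by (simp add: eigenpair_def)
    then obtain c where c: "\<forall>i. z $ i = c * of_real (v $ i)"
      using eigenvector_unique by blast
    then have "c = 0"
      using zk vk by auto
    then show False
      using c z(1) by (simp add: vec_eq_iff)
  qed
  then have N0: "N \<noteq> 0" "order (of_real r) N = 0"
    by (auto simp: order_0I)
  have "order (of_real r) (charpoly H) = order (of_real r) ([:- of_real r, 1:] * N)"
    using order_smult[OF vk, of "of_real r" "charpoly H"] unfolding eq by (rule sym)
  also have "\<dots> = order (of_real r) [:- of_real r, 1 :: complex:] + order (of_real r) N"
    using N0 by (intro order_mult) (simp del: mult_pCons_left)
  also have "\<dots> = 1"
    using N0 order_power_n_n[of "of_real r" 1] by simp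
  finally show ?thesis .
qed

section \<open>The sorted eigenvalue list and the second eigenvalue\<close>

definition rest :: "complex multiset" where
  "rest = eigenvalues_ms H - {#of_real r#}"

lemma eigenvalues_ms_eq: "eigenvalues_ms H = add_mset (of_real r) rest"
  using eigenpair_perron charpoly_nonzero poly_charpoly_eq_0_iff[of H "of_real r"]
  by (auto simp: rest_def eigenvalues_ms_def)

text \<open>Simplicity of the root is what matters: removing one copy of \<open>r\<close> leaves
  none behind.\<close>

lemma mem_rest_iff: "\<mu> \<in># rest \<longleftrightarrow> \<mu> \<noteq> of_real r \<and> (\<exists>y. eigenpair H \<mu> y)"
proof -
  have "\<mu> \<in># rest \<longleftrightarrow> 0 < count rest \<mu>"
    by simp
  also have "\<dots> \<longleftrightarrow> \<mu> \<noteq> of_real r \<and> 0 < order \<mu> (charpoly H)"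
    using charpoly_nonzero order_perron by (auto simp: rest_def eigenvalues_ms_def)
  finally show ?thesis
    using charpoly_nonzero by (simp add: order_gt_0_iff poly_charpoly_eq_0_iff)
qed

lemma re_eigs_desc_eq: "re_eigs_desc H = r # rev (sorted_list_of_multiset (image_mset Re rest))"
proof -
  have "x \<le> r" if "x \<in># image_mset Re rest" for x
  proof -
    from that obtain \<mu> y where "x = Re \<mu>" "eigenpair H \<mu> y"
      using mem_rest_iff by auto
    then show ?thesis
      using eigenvalue_norm_le complex_Re_le_cmod order_trans by blast
  qed
  then show ?thesis
    unfolding re_eigs_desc_def eigenvalues_ms_eq
    using rev_sorted_list_of_multiset_add_max[of "image_mset Re rest" r] by simp
qed

lemma lambda1_eq: "lambda1 H = r"
  by (simp add: lambda1_def re_eigs_desc_eq)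

context
  assumes card: "2 \<le> CARD('n)"
begin

lemma rest_nonempty: "rest \<noteq> {#}"
proof
  assume "rest = {#}"
  then have "size (eigenvalues_ms H) = 1"
    by (simp add: eigenvalues_ms_eq)
  then show False
    using card card_le_degree_charpoly[of H] by (simp add: eigenvalues_ms_def size_proots_complex)
qed

lemma rest_list_nonempty: "sorted_list_of_multiset (image_mset Re rest) \<noteq> []"
proof
  assume "sorted_list_of_multiset (image_mset Re rest) = []"
  then have "set (sorted_list_of_multiset (image_mset Re rest)) = {}"
    by (simp only: list.set)
  then show False
    using rest_nonempty by simp
qed

lemma re_lambda2_eq: "re_lambda2 H = last (sorted_list_of_multiset (image_mset Re rest))"
  unfolding re_lambda2_def re_eigs_desc_eq
  using hd_conv_nth[of "rev (sorted_list_of_multiset (image_mset Re rest))"] rest_list_nonempty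
  by (simp add: hd_rev)

text \<open>Together with \<open>ex_re_lambda2\<close> this identifies \<open>re_lambda2 H\<close>
  as the largest real part among eigenvalues with mean-zero eigenvectors, the only form in which it
  is used for the two bounds.\<close>

lemma re_lambda2_ge:
  assumes "eigenpair H \<mu> y" "(\<Sum>i\<in>UNIV. of_real (u $ i) * y $ i) = 0"
  shows "Re \<mu> \<le> re_lambda2 H"
proof -
  let ?xs = "sorted_list_of_multiset (image_mset Re rest)"
  have "\<mu> \<in># rest"
    using assms mean_zero_eigenvalue_neq by (auto simp: mem_rest_iff)
  then have "Re \<mu> \<in> set ?xs"
    by simp
  then obtain k where k: "k < length ?xs" "?xs ! k = Re \<mu>"
    by (metis in_set_conv_nth)
  then have "?xs ! k \<le> ?xs ! (length ?xs - 1)"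
    by (intro sorted_nth_mono) auto
  then show ?thesis
    using k unfolding re_lambda2_eq by (subst last_conv_nth) auto
qed

lemma ex_re_lambda2:
  obtains \<mu> y where "eigenpair H \<mu> y" "(\<Sum>i\<in>UNIV. of_real (u $ i) * y $ i) = 0" "Re \<mu> = re_lambda2 H"
proof -
  have "last (sorted_list_of_multiset (image_mset Re rest)) \<in> set (sorted_list_of_multiset (image_mset Re rest))"
    by (intro last_in_set rest_list_nonempty)
  then obtain \<mu> where "\<mu> \<in># rest" "Re \<mu> = re_lambda2 H"
    unfolding re_lambda2_eq by auto
  then show ?thesis
    using that mem_rest_iff eigenpair_mean by blast
qed

end

end

section \<open>Spectral gap and edge expansion\<close>

context perron
begin

definition weight :: real where
  "weight = (\<Sum>i\<in>UNIV. u $ i * v $ i)"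

sublocale chain: stationary_chain "\<lambda>i j. H $ i $ j * v $ j / (r * v $ i)" "\<lambda>i. u $ i * v $ i / weight"
proof
  fix i j
  have weight: "0 < weight"
    unfolding weight_def by (rule uv_sum_pos)
  show "0 \<le> H $ i $ j * v $ j / (r * v $ i)"
    using H_nonneg[of i j] v_pos[of i] v_pos[of j] r_pos by simp
  show "(\<Sum>j\<in>UNIV. H $ i $ j * v $ j / (r * v $ i)) = 1"
    using v_pos[of i] r_pos by (simp add: right_sum flip: sum_divide_distrib)
  show "0 < u $ i * v $ i / weight"
    using u_pos v_pos weight by simp
  show "(\<Sum>i\<in>UNIV. u $ i * v $ i / weight) = 1"
    using weight by (simp add: weight_def flip: sum_divide_distrib)
  have "u $ i * v $ i / weight * (H $ i $ j * v $ j / (r * v $ i)) = u $ i * H $ i $ j * (v $ j / (weight * r))" for i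
    using v_pos[of i] by simp
  then have "(\<Sum>i\<in>UNIV. u $ i * v $ i / weight * (H $ i $ j * v $ j / (r * v $ i)))
      = (\<Sum>i\<in>UNIV. u $ i * H $ i $ j) * (v $ j / (weight * r))"
    by (simp only: sum_distrib_right)
  then show "(\<Sum>i\<in>UNIV. u $ i * v $ i / weight * (H $ i $ j * v $ j / (r * v $ i))) = u $ j * v $ j / weight"
    using r_pos by (simp add: left_sum)
qed

lemma weight_pos: "0 < weight"
  unfolding weight_def by (rule uv_sum_pos)

lemma spectral_gap_eq: "spectral_gap H = 1 - re_lambda2 H / r"
  by (simp add: spectral_gap_def lambda1_eq)

lemma flow_ge_spectral_gap:
  assumes card: "2 \<le> CARD('n)" and S: "(\<Sum>i\<in>S. u $ i * v $ i / weight) \<le> 1/2"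
  shows "spectral_gap H / (15 * real CARD('n)) * (\<Sum>i\<in>S. u $ i * v $ i / weight) \<le> chain.flow S"
proof (cases "0 < spectral_gap H")
  case False
  then have "spectral_gap H / (15 * real CARD('n)) \<le> 0"
    by (simp add: divide_nonpos_nonneg)
  moreover have "0 \<le> (\<Sum>i\<in>S. u $ i * v $ i / weight)"
    by (intro sum_nonneg chain.p_nonneg)
  ultimately show ?thesis
    using chain.flow_nonneg[of S] mult_nonpos_nonneg order_trans by blast
next
  case True
  then show ?thesis
  proof (rule chain.flow_ge_gap[OF _ S])
    fix \<mu> and g :: "'n \<Rightarrow> complex"
    assume g: "\<And>i. (\<Sum>j\<in>UNIV. of_real (H $ i $ j * v $ j / (r * v $ i)) * g j) = \<mu> * g i"
      "(\<Sum>i\<in>UNIV. of_real (u $ i * v $ i / weight) * g i) = 0" "\<exists>i. g i \<noteq> 0"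
    \<comment> \<open>Conjugation by the diagonal matrix of \<open>v\<close> turns an eigenvector of
      the chain into one of \<open>H\<close>, with the eigenvalue multiplied by
      \<open>r\<close>.\<close>
    define y where "y = (\<chi> i. of_real (v $ i) * g i)"
    have vnz: "v $ i \<noteq> 0" for i
      using v_pos[of i] by simp
    have "(\<Sum>j\<in>UNIV. of_real (H $ i $ j) * y $ j) = of_real r * \<mu> * y $ i" for i
    proof -
      have "(\<Sum>j\<in>UNIV. of_real (H $ i $ j) * y $ j)
          = of_real (r * v $ i) * (\<Sum>j\<in>UNIV. of_real (H $ i $ j * v $ j / (r * v $ i)) * g j)"
        using vnz[of i] r_pos by (simp add: y_def sum_distrib_left mult_ac)
      then show ?thesis
        unfolding g(1) by (simp add: y_def)
    qed
    moreover have "y \<noteq> 0"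
      using g(3) vnz by (auto simp: y_def vec_eq_iff)
    ultimately have "eigenpair H (of_real r * \<mu>) y"
      by (simp add: eigenpair_def)
    moreover have "(\<Sum>i\<in>UNIV. of_real (u $ i) * y $ i)
        = of_real weight * (\<Sum>i\<in>UNIV. of_real (u $ i * v $ i / weight) * g i)"
      using weight_pos by (simp add: y_def sum_distrib_left mult_ac)
    ultimately have "Re (of_real r * \<mu>) \<le> re_lambda2 H"
      using g(2) by (intro re_lambda2_ge[OF card]) auto
    then show "Re \<mu> \<le> 1 - spectral_gap H"
      using r_pos by (simp add: spectral_gap_eq field_simps)
  qed
qed

lemma flow_lower_bound_le_spectral_gap:
  assumes card: "2 \<le> CARD('n)" and \<phi>: "0 \<le> \<phi>"
    and flow: "\<And>S. \<lbrakk>S \<noteq> {}; (\<Sum>i\<in>S. u $ i * v $ i / weight) \<le> 1/2\<rbrakk>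
      \<Longrightarrow> \<phi> * (\<Sum>i\<in>S. u $ i * v $ i / weight) \<le> chain.flow S"
  shows "\<phi>\<^sup>2 \<le> 2 * spectral_gap H"
proof -
  obtain \<mu> y where y: "eigenpair H \<mu> y" "(\<Sum>i\<in>UNIV. of_real (u $ i) * y $ i) = 0" "Re \<mu> = re_lambda2 H"
    using ex_re_lambda2[OF card] .
  obtain k where k: "y $ k \<noteq> 0"
    using y(1) by (auto simp: eigenpair_def vec_eq_iff)
  define g where "g i = y $ i / of_real (v $ i)" for i
  have vnz: "v $ i \<noteq> 0" for i
    using v_pos[of i] by simp
  have "\<phi>\<^sup>2 \<le> 2 * (1 - Re (\<mu> / of_real r))"
  proof (rule chain.cheeger[OF \<phi> flow])
    show "(\<Sum>j\<in>UNIV. of_real (H $ i $ j * v $ j / (r * v $ i)) * g j) = \<mu> / of_real r * g i" for i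
    proof -
      have "(\<Sum>j\<in>UNIV. of_real (H $ i $ j * v $ j / (r * v $ i)) * g j)
          = (\<Sum>j\<in>UNIV. of_real (H $ i $ j) * y $ j) / of_real (r * v $ i)"
        using vnz by (simp add: g_def sum_divide_distrib)
      then show ?thesis
        using y(1) by (simp add: g_def eigenpair_def)
    qed
    have "(\<Sum>i\<in>UNIV. of_real (u $ i * v $ i / weight) * g i) = (\<Sum>i\<in>UNIV. of_real (u $ i) * y $ i) / of_real weight"
      using vnz by (simp add: g_def sum_divide_distrib)
    then show "(\<Sum>i\<in>UNIV. of_real (u $ i * v $ i / weight) * g i) = 0"
      by (simp add: y(2))
    show "g k \<noteq> 0"
      using k vnz by (simp add: g_def)
  qed
  then show ?thesis
    by (simp add: spectral_gap_eq y(3))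
qed

lemma spectral_gap_le_2:
  assumes "2 \<le> CARD('n)"
  shows "spectral_gap H \<le> 2"
proof -
  obtain \<mu> y where y: "eigenpair H \<mu> y" "Re \<mu> = re_lambda2 H"
    using ex_re_lambda2[OF assms] .
  then have "\<bar>re_lambda2 H\<bar> \<le> r"
    using eigenvalue_norm_le abs_Re_le_cmod order_trans by metis
  then show ?thesis
    using r_pos by (simp add: spectral_gap_eq field_simps)
qed

end

text \<open>The roots of \<open>H\<close> and its transpose agree, because evaluating
  \<open>u H v\<close> in two ways multiplies the positive number \<open>u \<bullet> v\<close> by
  either. With \<open>lambda1 H\<close> known to be this root, \<open>u\<close> and \<open>v\<close>
  witness both uses of \<open>SOME\<close>.\<close>

lemma perron_pf:
  assumes "irreducible_mat H"
  shows "perron H (lambda1 H) (pf_left H) (pf_right H)"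
proof -
  obtain r v where v: "0 < r" "\<And>i. 0 < v $ i" "H *v v = r *\<^sub>R v"
    using ex_perron_vector[OF assms] by blast
  obtain s u where u: "0 < s" "\<And>i. 0 < u $ i" "transpose H *v u = s *\<^sub>R u"
    using ex_perron_vector[OF irreducible_transpose[OF assms]] by blast
  have "s * (u \<bullet> v) = r * (u \<bullet> v)"
    using v(3) u(3) dot_lmul_matrix[of u H v] by (simp add: transpose_matrix_vector)
  moreover have "0 < u \<bullet> v"
    unfolding inner_vec_def using u(2) v(2) by (intro sum_pos) auto
  ultimately have "s = r" by simp
  with u v assms interpret perron H r u v
    by unfold_locales auto
  have r: "lambda1 H = r"
    by (rule lambda1_eq)
  have left: "(\<forall>i. 0 < pf_left H $ i) \<and> transpose H *v pf_left H = lambda1 H *\<^sub>R pf_left H"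
    unfolding pf_left_def by (rule someI[of _ u]) (use u \<open>s = r\<close> r in auto)
  have right: "(\<forall>i. 0 < pf_right H $ i) \<and> H *v pf_right H = lambda1 H *\<^sub>R pf_right H"
    unfolding pf_right_def by (rule someI[of _ v]) (use v r in auto)
  show ?thesis
    using left right assms v(1) r by unfold_locales auto
qed

lemma indic_inner_diag:
  "indic S \<bullet> ((diag_mat u ** H ** diag_mat v) *v indic T) = (\<Sum>i\<in>S. \<Sum>j\<in>T. u $ i * H $ i $ j * v $ j)"
proof -
  have "(diag_mat u ** H ** diag_mat v) $ i $ j = u $ i * H $ i $ j * v $ j" for i j
    unfolding diag_mat_def matrix_matrix_mult_def
    by (simp add: if_distrib[of "\<lambda>a. a * _"] if_distrib[of "\<lambda>a. _ * a"] cong: if_cong)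
  then show ?thesis
    by (simp add: inner_vec_def indic_def matrix_vector_mult_def if_distrib[of "\<lambda>a. a * _"]
        if_distrib[of "\<lambda>a. _ * a"] sum.If_cases cong: if_cong)
qed

lemma irreducible_bounds:
  fixes H :: "real^'n::finite^'n"
  assumes card: "2 \<le> CARD('n)" and H: "irreducible_mat H"
  shows "spectral_gap H / (15 * real CARD('n)) \<le> edge_expansion H"
    and "(edge_expansion H)\<^sup>2 \<le> 2 * spectral_gap H"
    and "0 \<le> edge_expansion H" and "edge_expansion H \<le> 1" and "spectral_gap H \<le> 2"
proof -
  let ?u = "pf_left H" and ?v = "pf_right H"
  interpret perron H "lambda1 H" ?u ?v
    by (rule perron_pf[OF H])
  let ?p = "\<lambda>i. ?u $ i * ?v $ i / weight"
  define F where "F = {S :: 'n set. S \<noteq> {} \<and> (\<Sum>i\<in>S. ?p i) \<le> 1/2}"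
  have phi: "phi_set H S = chain.flow S / (\<Sum>i\<in>S. ?p i)" for S
  proof -
    have "(\<Sum>i\<in>S. \<Sum>j\<in>- S. ?u $ i * H $ i $ j * ?v $ j) = lambda1 H * weight * chain.flow S"
      unfolding chain.flow_def sum_distrib_left
      using r_pos weight_pos v_pos
      by (intro sum.cong refl) (simp add: field_simps less_imp_neq[symmetric])
    moreover have "(\<Sum>i\<in>S. \<Sum>j\<in>UNIV. ?u $ i * H $ i $ j * ?v $ j) = lambda1 H * weight * (\<Sum>i\<in>S. ?p i)"
      using weight_pos by (simp add: mult.assoc right_sum sum_distrib_left flip: sum_distrib_left)
        (simp add: sum_distrib_left mult_ac)
    ultimately show ?thesis
      using r_pos weight_pos by (simp add: phi_set_def indic_inner_diag Let_def)
  qed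
  have "(\<Sum>i\<in>S. ?p i) \<le> 1/2 \<longleftrightarrow> (\<Sum>i\<in>S. ?u $ i * ?v $ i) \<le> 1/2 * weight" for S
    using weight_pos by (simp add: field_simps flip: sum_divide_distrib)
  then have edge: "edge_expansion H = Min (phi_set H ` F)"
    unfolding edge_expansion_def F_def Let_def by (simp add: weight_def)
  have pos: "0 < (\<Sum>i\<in>S. ?p i)" if "S \<in> F" for S
    using that chain.p_pos by (intro sum_pos) (auto simp: F_def)
  \<comment> \<open>With at least two states some weight is at most 1/2, so a singleton is
    admissible and \<open>Min\<close> ranges over a nonempty set.\<close>
  obtain i where "?p i \<le> 1/2"
  proof (rule ccontr)
    assume "\<not> thesis"
    then have big: "1/2 < ?p i" for i
      using that not_le by blast
    have "1 \<le> real CARD('n) * (1/2)"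
      using card by simp
    also have "\<dots> = (\<Sum>i\<in>(UNIV :: 'n set). 1/2)"
      by simp
    also have "\<dots> < (\<Sum>i\<in>UNIV. ?p i)"
      using big by (intro sum_strict_mono) auto
    finally show False
      using chain.p_sum by simp
  qed
  then have "{i} \<in> F"
    by (simp add: F_def)
  then have "F \<noteq> {}" by blast
  then have in_F: "edge_expansion H \<in> phi_set H ` F" and le_F: "\<And>S. S \<in> F \<Longrightarrow> edge_expansion H \<le> phi_set H S"
    unfolding edge by (auto intro!: Min_in)
  then obtain S where S: "S \<in> F" "edge_expansion H = chain.flow S / (\<Sum>i\<in>S. ?p i)"
    using phi by auto
  show "spectral_gap H / (15 * real CARD('n)) \<le> edge_expansion H"
    using flow_ge_spectral_gap[OF card, of S] S pos[OF S(1)] by (simp add: F_def pos_le_divide_eq)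
  show nonneg: "0 \<le> edge_expansion H"
    using S pos[OF S(1)] chain.flow_nonneg[of S] by simp
  show "edge_expansion H \<le> 1"
    using S pos[OF S(1)] chain.flow_le[of S] by simp
  show "(edge_expansion H)\<^sup>2 \<le> 2 * spectral_gap H"
  proof (rule flow_lower_bound_le_spectral_gap[OF card nonneg])
    fix T :: "'n set"
    assume "T \<noteq> {}" "(\<Sum>i\<in>T. ?p i) \<le> 1/2"
    then have T: "T \<in> F" by (simp add: F_def)
    show "edge_expansion H * (\<Sum>i\<in>T. ?p i) \<le> chain.flow T"
      using le_F[OF T] pos[OF T] by (simp add: phi pos_le_divide_eq)
  qed
  show "spectral_gap H \<le> 2"
    by (rule spectral_gap_le_2[OF card])
qed

section \<open>Passage to the limit for arbitrary nonnegative matrices\<close>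

lemma antimono_tendsto_at_right:
  fixes g :: "real \<Rightarrow> real"
  assumes mono: "\<And>x y. \<lbrakk>0 < x; x \<le> y\<rbrakk> \<Longrightarrow> g y \<le> g x" and bound: "\<And>x. 0 < x \<Longrightarrow> g x \<le> B"
  shows "(g \<longlongrightarrow> (SUP x\<in>{0<..}. g x)) (at_right 0)"
proof (rule order_tendstoI)
  have bdd: "bdd_above (g ` {0<..})"
    using bound by (intro bdd_aboveI2[of _ _ B]) auto
  show "\<forall>\<^sub>F x in at_right 0. a < g x" if a: "a < (SUP x\<in>{0<..}. g x)" for a
  proof -
    obtain x where x: "0 < x" "a < g x"
      using a less_cSUP_iff[OF _ bdd, of a] by auto
    show ?thesis
      by (rule eventually_at_rightI[of 0 x]) (use x mono in \<open>auto intro: less_le_trans\<close>)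
  qed
  show "\<forall>\<^sub>F x in at_right 0. g x < a" if "(SUP x\<in>{0<..}. g x) < a" for a
    by (rule eventually_at_rightI[of 0 1])
      (use that cSUP_upper[OF _ bdd] in \<open>auto intro: le_less_trans\<close>)
qed

lemma near_irred_mono: "\<epsilon> \<le> \<delta> \<Longrightarrow> near_irred R \<epsilon> \<subseteq> near_irred R \<delta>"
  by (auto simp: near_irred_def)

lemma near_irred_nonempty:
  fixes R :: "real^'n::finite^'n"
  assumes R: "nonneg_mat R" and \<epsilon>: "0 < \<epsilon>"
  shows "near_irred R \<epsilon> \<noteq> {}"
proof -
  let ?n = "real CARD('n)"
  \<comment> \<open>Spreading \<open>\<epsilon> / n\<close> over all n^2 entries makes the Frobenius
    distance exactly \<epsilon> and every entry positive.\<close>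
  define H where "H = (\<chi> i j. R $ i $ j + \<epsilon> / ?n)"
  have pos: "0 < H $ i $ j" for i j
    using R \<epsilon> by (simp add: H_def nonneg_mat_def add_nonneg_pos)
  then have "matpow H 1 $ s $ t > 0" for s t
    by simp
  then have "irreducible_mat H"
    unfolding irreducible_mat_def nonneg_mat_def using pos by (meson less_imp_le zero_less_one)
  moreover have "(\<Sum>i\<in>(UNIV :: 'n set). \<Sum>j\<in>(UNIV :: 'n set). (R $ i $ j - H $ i $ j)\<^sup>2) = \<epsilon>\<^sup>2"
    by (simp add: H_def power_divide power2_eq_square)
  then have "frob_dist R H = \<epsilon>"
    using \<epsilon> by (simp add: frob_dist_def)
  ultimately show ?thesis
    by (auto simp: near_irred_def)
qed

text \<open>\<open>Lim\<close> carries information only once convergence is known. It holds because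
  the infima grow as \<epsilon> shrinks and stay below \<open>B\<close>.\<close>

lemma Inf_near_irred_tendsto:
  fixes R :: "real^'n::finite^'n"
  assumes R: "nonneg_mat R" and f: "\<And>H. irreducible_mat H \<Longrightarrow> 0 \<le> f H \<and> f H \<le> (B :: real)"
  shows "((\<lambda>\<epsilon>. Inf (f ` near_irred R \<epsilon>)) \<longlongrightarrow> Lim (at_right 0) (\<lambda>\<epsilon>. Inf (f ` near_irred R \<epsilon>))) (at_right 0)"
proof -
  have bdd: "bdd_below (f ` near_irred R \<epsilon>)" for \<epsilon>
    using f by (intro bdd_belowI2[of _ 0]) (auto simp: near_irred_def)
  have "Inf (f ` near_irred R y) \<le> Inf (f ` near_irred R x)" if "0 < x" "x \<le> y" for x y
    using near_irred_nonempty[OF R that(1)] near_irred_mono[OF that(2), of R]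
    by (intro cInf_superset_mono bdd image_mono) auto
  moreover have "Inf (f ` near_irred R x) \<le> B" if x: "0 < x" for x
  proof -
    obtain H where H: "H \<in> near_irred R x"
      using near_irred_nonempty[OF R x] by auto
    then have "Inf (f ` near_irred R x) \<le> f H"
      by (intro cInf_lower bdd) auto
    then show ?thesis
      using f H by (force simp: near_irred_def)
  qed
  ultimately have "((\<lambda>\<epsilon>. Inf (f ` near_irred R \<epsilon>)) \<longlongrightarrow> (SUP x\<in>{0<..}. Inf (f ` near_irred R x))) (at_right 0)"
    by (rule antimono_tendsto_at_right)
  then show ?thesis
    using tendsto_Lim by (metis trivial_limit_at_right_real)
qed

theorem theorem1p1:
  fixes R :: "real^'n::finite^'n"
  assumes "CARD('n) \<ge> 2"
    and "nonneg_mat R"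
  shows "(1/15) * (spectral_gap_gen R / real CARD('n)) \<le> edge_expansion_gen R
       \<and> edge_expansion_gen R \<le> sqrt (2 * spectral_gap_gen R)"
proof -
  let ?n = "real CARD('n)"
  let ?D = "\<lambda>\<epsilon>. Inf (spectral_gap ` near_irred R \<epsilon>)" and ?E = "\<lambda>\<epsilon>. Inf (edge_expansion ` near_irred R \<epsilon>)"
  note bounds = irreducible_bounds[OF assms(1)]
  have gap_nonneg: "0 \<le> spectral_gap H" if "irreducible_mat H" for H :: "real^'n^'n"
    using bounds(2)[OF that] zero_le_power2[of "edge_expansion H"] by linarith
  have D: "(?D \<longlongrightarrow> spectral_gap_gen R) (at_right 0)"
    unfolding spectral_gap_gen_def
    by (rule Inf_near_irred_tendsto[OF assms(2), of _ 2]) (use gap_nonneg bounds in auto)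
  have E: "(?E \<longlongrightarrow> edge_expansion_gen R) (at_right 0)"
    unfolding edge_expansion_gen_def
    by (rule Inf_near_irred_tendsto[OF assms(2), of _ 1]) (use bounds in auto)
  have bdd_D: "bdd_below (spectral_gap ` near_irred R \<epsilon>)" for \<epsilon>
    using gap_nonneg by (intro bdd_belowI2[of _ 0]) (auto simp: near_irred_def)
  have bdd_E: "bdd_below (edge_expansion ` near_irred R \<epsilon>)" for \<epsilon>
    using bounds(3) by (intro bdd_belowI2[of _ 0]) (auto simp: near_irred_def)
  have ev: "\<forall>\<^sub>F \<epsilon> in at_right 0. (0::real) < \<epsilon>"
    by (rule eventually_at_right_less)
  have lower: "(1/15) * (?D \<epsilon> / ?n) \<le> ?E \<epsilon>" if \<epsilon>: "0 < \<epsilon>" for \<epsilon>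
  proof (rule cINF_greatest[OF near_irred_nonempty[OF assms(2) \<epsilon>]])
    fix H assume H: "H \<in> near_irred R \<epsilon>"
    then have "?D \<epsilon> \<le> spectral_gap H"
      by (intro cInf_lower bdd_D) auto
    then have "(1/15) * (?D \<epsilon> / ?n) \<le> spectral_gap H / (15 * ?n)"
      by (simp add: divide_right_mono)
    also have "\<dots> \<le> edge_expansion H"
      using bounds(1)[of H] H by (simp add: near_irred_def)
    finally show "(1/15) * (?D \<epsilon> / ?n) \<le> edge_expansion H" .
  qed
  have upper: "?E \<epsilon> \<le> sqrt (2 * ?D \<epsilon>)" if \<epsilon>: "0 < \<epsilon>" for \<epsilon>
  proof -
    have E0: "0 \<le> ?E \<epsilon>"
      using bounds(3) by (intro cINF_greatest near_irred_nonempty assms \<epsilon>) (auto simp: near_irred_def)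
    \<comment> \<open>In squared form the bound holds against each \<open>spectral_gap H\<close>
      separately and so passes to the infimum; squaring uses that \<open>?E\<close> is
      nonnegative.\<close>
    have "(?E \<epsilon>)\<^sup>2 / 2 \<le> ?D \<epsilon>"
    proof (rule cINF_greatest[OF near_irred_nonempty[OF assms(2) \<epsilon>]])
      fix H assume H: "H \<in> near_irred R \<epsilon>"
      then have "?E \<epsilon> \<le> edge_expansion H"
        by (intro cInf_lower bdd_E) auto
      then have "(?E \<epsilon>)\<^sup>2 \<le> (edge_expansion H)\<^sup>2"
        using E0 by (intro power_mono)
      then show "(?E \<epsilon>)\<^sup>2 / 2 \<le> spectral_gap H"
        using bounds(2)[of H] H by (simp add: near_irred_def)
    qed
    then show ?thesis
      by (intro real_le_rsqrt) simp
  qed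
  have "(1/15) * (spectral_gap_gen R / ?n) \<le> edge_expansion_gen R"
    by (rule tendsto_le[OF trivial_limit_at_right_real E tendsto_mult[OF tendsto_const tendsto_divide[OF D tendsto_const]]])
      (use eventually_mono[OF ev lower] in auto)
  moreover have "edge_expansion_gen R \<le> sqrt (2 * spectral_gap_gen R)"
    by (rule tendsto_le[OF trivial_limit_at_right_real tendsto_real_sqrt[OF tendsto_mult[OF tendsto_const D]] E])
      (rule eventually_mono[OF ev upper])
  ultimately show ?thesis by blast
qed

end
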